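(* If $X,Y,Z,\pi$ is the data of a gated decomposition of a betweenness space $X$ and $W=Y\cap Z$, then the inclusions $j_Y:W\to Y$, $j_Z:W\to Z$, $i_Y:Y\to X$, $i_Z:Z\to X$ induce a short exact sequence (in each degree) $$0\to\mathrm{MH}_*(W)\xrightarrow{\langle (j_Y)_*,\,-(j_Z)_*\rangle}\mathrm{MH}_*(Y)\oplus\mathrm{MH}_*(Z)\xrightarrow{(i_Y)_*\oplus(i_Z)_*}\mathrm{MH}_*(X)\to0,$$ where the second map is $(u,v)\mapsto (i_Y)_*u+(i_Z)_*v$.
   Context: A betweenness space is a set $X$ with a map $[\cdot,\cdot]:X\times X\to\mathcal P(X)$ such that: (B1) $x,z\in[x,z]$; (B2) $y\in[x,z]$ implies $[x,y]\subseteq[x,z]$ and $[y,z]\subseteq[x,z]$; (B3) if $w,y\in[x,z]$, then $w\in[x,y]$ iff $y\in[w,z]$. A subset of $X$ is a betweenness space with intervals intersected with the subset. A $k$-path in $X$ ($k\ge0$) is a tuple $\langle x_0,\dots,x_k\rangle$ with $x_i\ne x_{i+1}$ for all $i<k$. $\mathrm{MC}_k(X)$ is the free abelian group on $k$-paths, with boundary $\partial_k=\sum_{i=1}^{k-1}(-1)^i\partial_{k,i}$, where $\partial_{k,i}\langle x_0,\dots,x_k\rangle=\langle x_0,\dots,\widehat{x_i},\dots,x_k\rangle$ if $x_i\in[x_{i-1},x_{i+1}]$, and $0$ otherwise (a tuple with consecutive equal entries being read as $0$). $\mathrm{MH}_*(X)$ is its homology. The inclusion of a subset induces the evident inclusion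 of complexes. Good sets: for a tuple $\mathbf x=\langle x_0,\dots,x_k\rangle$ let $d_i\mathbf x$ be the tuple with $x_i$ removed. For endpoint indices with $k\ge1$, "$x_i\in[x_{i-1},x_{i+1}]$" is read as $x_0=x_1$ when $i=0$, and as $x_{k-1}=x_k$ when $i=k$ (likewise for images under $f$). For a map $f:A\to B$ between betweenness spaces, a set $G$ of tuples ($k\ge0$, repetitions allowed) in $A$ is $f$-good if: (G1) for $\mathbf x\in G$ and each $i$: $fx_i\in[fx_{i-1},fx_{i+1}]$ iff ($x_i\in[x_{i-1},x_{i+1}]$ and $d_i\mathbf x\in G$); (G2) if $\mathbf x\notin G$ and $x_i\in[x_{i-1},x_{i+1}]$, then $d_i\mathbf x\notin G$. There is a maximal $f$-good set, denoted $\hat G(f)$ (the union of all $f$-good sets). A gated decomposition of $X$ consists of subsets $Y,Z$ of $X$ with $X=Y\cup Z$ and a map $\pi:Z\to Y\cap Z$ such that: for all $z\in Z$, $y\in Y$, $\pi(z)\in[z,y]$; $\pi|_{Y\cap Z}=\mathrm{Id}_{Y\cap Z}$; and $\hat G(\pi)$ contains all tuples of points of $Y\cap Z$.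
   Formalization: Two hypotheses are added: the boundary on MC(X) squares to zero (B1–B3 alone do not ensure this, so MH may be undefined), and π(z) lies in [y,z] as well as in [z,y] (automatic for symmetric intervals; without it the second map can fail to be onto). *)

theory Defs
  imports "HOL-Algebra.Free_Abelian_Groups"
begin

definition betweenness_space :: "'a set \<Rightarrow> ('a \<Rightarrow> 'a \<Rightarrow> 'a set) \<Rightarrow> bool" where
  "betweenness_space X I \<longleftrightarrow>
     (\<forall>x\<in>X. \<forall>z\<in>X. I x z \<subseteq> X) \<and>
     (\<forall>x\<in>X. \<forall>z\<in>X. x \<in> I x z \<and> z \<in> I x z) \<and>
     (\<forall>x\<in>X. \<forall>z\<in>X. \<forall>y\<in>I x z. I x y \<subseteq> I x z \<and> I y z \<subseteq> I x z) \<and>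
     (\<forall>x\<in>X. \<forall>z\<in>X. \<forall>w\<in>I x z. \<forall>y\<in>I x z. w \<in> I x y \<longleftrightarrow> y \<in> I w z)"

definition sub_intervals :: "('a \<Rightarrow> 'a \<Rightarrow> 'a set) \<Rightarrow> 'a set \<Rightarrow> 'a \<Rightarrow> 'a \<Rightarrow> 'a set" where
  "sub_intervals I A = (\<lambda>x z. I x z \<inter> A)"

definition drop_at :: "nat \<Rightarrow> 'a list \<Rightarrow> 'a list" where
  "drop_at i xs = take i xs @ drop (Suc i) xs"


text \<open>A tuple \<open>\<langle>x\<^sub>0, \<dots>, x\<^sub>k\<rangle>\<close> is a list of length \<open>k + 1\<close>.\<close>

definition k_paths :: "'a set \<Rightarrow> nat \<Rightarrow> 'a list set" where
  "k_paths X k = {xs. length xs = Suc k \<and> set xs \<subseteq> X \<and> distinct_adj xs}"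

definition MC :: "'a set \<Rightarrow> nat \<Rightarrow> ('a list \<Rightarrow>\<^sub>0 int) monoid" where
  "MC X k = free_Abelian_group (k_paths X k)"

definition MC_face :: "('a \<Rightarrow> 'a \<Rightarrow> 'a set) \<Rightarrow> nat \<Rightarrow> 'a list \<Rightarrow> ('a list \<Rightarrow>\<^sub>0 int)" where
  "MC_face I i xs =
     (if xs ! i \<in> I (xs ! (i - 1)) (xs ! (i + 1)) \<and> distinct_adj (drop_at i xs)
      then frag_of (drop_at i xs) else 0)"

text \<open>For \<open>k \<le> 1\<close> the sum is empty, so that the boundaries in degrees 0 and 1 are 0.\<close>

definition MC_boundary ::
    "('a \<Rightarrow> 'a \<Rightarrow> 'a set) \<Rightarrow> nat \<Rightarrow> ('a list \<Rightarrow>\<^sub>0 int) \<Rightarrow> ('a list \<Rightarrow>\<^sub>0 int)" where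
  "MC_boundary I k =
     frag_extend (\<lambda>xs. \<Sum>i\<in>{1..<k}. frag_cmul ((-1) ^ i) (MC_face I i xs))"

definition MC_cycles :: "'a set \<Rightarrow> ('a \<Rightarrow> 'a \<Rightarrow> 'a set) \<Rightarrow> nat \<Rightarrow> ('a list \<Rightarrow>\<^sub>0 int) set" where
  "MC_cycles X I k = {c \<in> carrier (MC X k). MC_boundary I k c = 0}"

definition MC_boundaries :: "'a set \<Rightarrow> ('a \<Rightarrow> 'a \<Rightarrow> 'a set) \<Rightarrow> nat \<Rightarrow> ('a list \<Rightarrow>\<^sub>0 int) set" where
  "MC_boundaries X I k = MC_boundary I (Suc k) ` carrier (MC X (Suc k))"

definition MH ::
    "'a set \<Rightarrow> ('a \<Rightarrow> 'a \<Rightarrow> 'a set) \<Rightarrow> nat \<Rightarrow> ('a list \<Rightarrow>\<^sub>0 int) set monoid" where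
  "MH X I k = subgroup_generated (MC X k) (MC_cycles X I k) Mod MC_boundaries X I k"

text \<open>
  For \<open>A \<subseteq> X\<close> the chains on \<open>A\<close> are literally chains on \<open>X\<close>, and the inclusion of complexes is
  the identity on them. The induced map therefore sends the coset of a cycle \<open>c\<close> modulo the
  boundaries of \<open>A\<close> to the coset of \<open>c\<close> modulo the boundaries of \<open>X\<close>; the latter is the sum of
  the former and the group of boundaries of \<open>X\<close>.
\<close>

definition MH_incl ::
    "'a set \<Rightarrow> ('a \<Rightarrow> 'a \<Rightarrow> 'a set) \<Rightarrow> nat \<Rightarrow> ('a list \<Rightarrow>\<^sub>0 int) set \<Rightarrow> ('a list \<Rightarrow>\<^sub>0 int) set" where
  "MH_incl X I k C = MC_boundaries X I k <#>\<^bsub>MC X k\<^esub> C"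


definition tuples :: "'a set \<Rightarrow> 'a list set" where
  "tuples A = {xs. xs \<noteq> [] \<and> set xs \<subseteq> A}"

text \<open>
  The relation \<open>x\<^sub>i \<in> [x\<^sub>i\<^sub>-\<^sub>1, x\<^sub>i\<^sub>+\<^sub>1]\<close>, with its convention at the endpoints; meaningful for
  \<open>i < length xs\<close> and \<open>length xs \<ge> 2\<close>.
\<close>

definition between_at :: "('a \<Rightarrow> 'a \<Rightarrow> 'a set) \<Rightarrow> 'a list \<Rightarrow> nat \<Rightarrow> bool" where
  "between_at I xs i \<longleftrightarrow>
     (if i = 0 then xs ! 0 = xs ! 1
      else if Suc i = length xs then xs ! (i - 1) = xs ! i
      else xs ! i \<in> I (xs ! (i - 1)) (xs ! (i + 1)))"

text \<open>\<open>I\<close> and \<open>J\<close> are the intervals of the domain \<open>A\<close> and of the codomain of \<open>f\<close>.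
  Nothing is demanded of one-element tuples, which have no faces.\<close>

definition good_set ::
    "'a set \<Rightarrow> ('a \<Rightarrow> 'a \<Rightarrow> 'a set) \<Rightarrow> ('b \<Rightarrow> 'b \<Rightarrow> 'b set) \<Rightarrow> ('a \<Rightarrow> 'b) \<Rightarrow> 'a list set \<Rightarrow> bool" where
  "good_set A I J f G \<longleftrightarrow>
     G \<subseteq> tuples A \<and>
     (\<forall>xs\<in>G. length xs \<ge> 2 \<longrightarrow> (\<forall>i<length xs.
        between_at J (map f xs) i \<longleftrightarrow> between_at I xs i \<and> drop_at i xs \<in> G)) \<and>
     (\<forall>xs\<in>tuples A - G. length xs \<ge> 2 \<longrightarrow> (\<forall>i<length xs.
        between_at I xs i \<longrightarrow> drop_at i xs \<notin> G))"

definition max_good_set ::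
    "'a set \<Rightarrow> ('a \<Rightarrow> 'a \<Rightarrow> 'a set) \<Rightarrow> ('b \<Rightarrow> 'b \<Rightarrow> 'b set) \<Rightarrow> ('a \<Rightarrow> 'b) \<Rightarrow> 'a list set" where
  "max_good_set A I J f = \<Union> {G. good_set A I J f G}"

definition gated_decomposition ::
    "'a set \<Rightarrow> ('a \<Rightarrow> 'a \<Rightarrow> 'a set) \<Rightarrow> 'a set \<Rightarrow> 'a set \<Rightarrow> ('a \<Rightarrow> 'a) \<Rightarrow> bool" where
  "gated_decomposition X I Y Z \<pi> \<longleftrightarrow>
     X = Y \<union> Z \<and> \<pi> \<in> Z \<rightarrow> Y \<inter> Z \<and>
     (\<forall>z\<in>Z. \<forall>y\<in>Y. \<pi> z \<in> I z y) \<and>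
     (\<forall>w\<in>Y \<inter> Z. \<pi> w = w) \<and>
     tuples (Y \<inter> Z) \<subseteq> max_good_set Z (sub_intervals I Z) (sub_intervals I (Y \<inter> Z)) \<pi>"


text \<open>The sequence \<open>0 \<rightarrow> A \<rightarrow> B \<rightarrow> C \<rightarrow> 0\<close> is exact. The library's \<open>short_exact_sequence\<close> requires
  the three groups to have elements of the same type, which rules out a product in the middle.\<close>

definition short_exact ::
    "('a, 'm) monoid_scheme \<Rightarrow> ('b, 'n) monoid_scheme \<Rightarrow> ('c, 'o) monoid_scheme \<Rightarrow>
     ('a \<Rightarrow> 'b) \<Rightarrow> ('b \<Rightarrow> 'c) \<Rightarrow> bool" where
  "short_exact A B C f g \<longleftrightarrow>
     comm_group A \<and> comm_group B \<and> comm_group C \<and>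
     f \<in> mon A B \<and> f ` carrier A = kernel B C g \<and> g \<in> epi B C"

end

theory Submission
  imports Defs
begin

text \<open>
  Write \<open>W = Y \<inter> Z\<close>. As for spaces, the sequence is a Mayer-Vietoris sequence that breaks up into
  short pieces, for two reasons.

  Excision: the chains \<open>MC(Y) + MC(Z)\<close> compute the homology of \<open>X\<close>. What has to be shown is that the
  quotient of \<open>MC(X)\<close> by this subcomplex, which is free on the mixed paths (those contained neither
  in \<open>Y\<close> nor in \<open>Z\<close>), is acyclic. A mixed path, when its entries in \<open>W\<close> are ignored, somewhere
  passes from a point \<open>z\<close> of \<open>Z - W\<close> to a point of \<open>Y - W\<close>, or back. Since the gate \<open>\<pi> z\<close> lies
  between \<open>z\<close> and every point of \<open>Y\<close>, it can be inserted next to \<open>z\<close>, on the side of \<open>Y\<close>, and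
  deleting it again is an admissible face. With the appropriate sign, inserting the gate is a
  contracting homotopy up to faces that delete a point outside \<open>W\<close>
  (\<open>homotopy_identity\<close>). Such faces lower the number of points outside \<open>W\<close>, so that
  induction on this number gives \<open>excision\<close>: a chain whose boundary lies in \<open>MC(Y) + MC(Z)\<close> lies
  there itself, up to a boundary.

  Retraction: applying \<open>\<pi>\<close> to the paths of \<open>Z\<close> that belong to the maximal good set, and sending the
  other paths to \<open>0\<close>, is a chain map \<open>MC(Z) \<rightarrow> MC(W)\<close> (\<open>good_map_boundary\<close>); the two conditions on
  good sets are what makes it commute with each face. It is the identity on \<open>MC(W)\<close>, because all
  tuples of \<open>W\<close> are in that set.

  The retraction makes the homology of \<open>W\<close> inject into that of \<open>Z\<close> (\<open>inclusion_injective\<close>).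
  Excision gives exactness in the middle (\<open>exact_in_middle\<close>). Both give surjectivity
  (\<open>cycle_decomposition\<close>): excision writes a cycle, up to a boundary, as a sum of chains \<open>a\<close> on \<open>Y\<close>
  and \<open>b\<close> on \<open>Z\<close>, and moving the retract of \<open>b\<close> from the second summand to the first makes both
  of them cycles.
\<close>

section \<open>Inserting and deleting list entries\<close>

definition insert_at :: "nat \<Rightarrow> 'a \<Rightarrow> 'a list \<Rightarrow> 'a list" where
  "insert_at t g xs = take t xs @ g # drop t xs"

lemma length_drop_at [simp]: "i < length xs \<Longrightarrow> length (drop_at i xs) = length xs - 1"
  by (simp add: drop_at_def)

lemma length_insert_at [simp]: "length (insert_at t g xs) = Suc (length xs)"
  by (simp add: insert_at_def)

lemma nth_drop_at:
  "i < length xs \<Longrightarrow> j < length xs - 1 \<Longrightarrow> drop_at i xs ! j = (if j < i then xs ! j else xs ! Suc j)"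
  by (auto simp: drop_at_def nth_append)

lemma nth_insert_at:
  "t \<le> length xs \<Longrightarrow> j \<le> length xs \<Longrightarrow>
   insert_at t g xs ! j = (if j < t then xs ! j else if j = t then g else xs ! (j - 1))"
  by (auto simp: insert_at_def nth_append nth_Cons')

lemma set_insert_at [simp]: "set (insert_at t g xs) = insert g (set xs)"
  by (metis append_take_drop_id insert_at_def list.simps(15) set_append Un_insert_right)

lemma set_drop_at_subset: "set (drop_at i xs) \<subseteq> set xs"
  by (auto simp: drop_at_def dest: in_set_takeD in_set_dropD)

lemma drop_at_insert_at [simp]: "t \<le> length xs \<Longrightarrow> drop_at t (insert_at t g xs) = xs"
  by (rule nth_equalityI) (auto simp: nth_drop_at nth_insert_at)

lemma insert_at_drop_at: "i < length xs \<Longrightarrow> insert_at i (xs ! i) (drop_at i xs) = xs"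
  by (rule nth_equalityI) (auto simp: nth_drop_at nth_insert_at)

lemma drop_at_insert_at_before:
  assumes "i < t" "t \<le> length xs"
  shows "drop_at i (insert_at t g xs) = insert_at (t - 1) g (drop_at i xs)"
  using assms by (intro nth_equalityI) (auto simp: nth_drop_at nth_insert_at)

lemma drop_at_insert_at_after:
  assumes "t \<le> i" "i < length xs"
  shows "drop_at (Suc i) (insert_at t g xs) = insert_at t g (drop_at i xs)"
  using assms by (intro nth_equalityI) (auto simp: nth_drop_at nth_insert_at)

lemma filter_insert_at: "\<not> P g \<Longrightarrow> filter P (insert_at t g xs) = filter P xs"
  by (metis append_take_drop_id filter.simps(2) filter_append insert_at_def)

lemma filter_drop_at:
  "i < length xs \<Longrightarrow> \<not> P (xs ! i) \<Longrightarrow> filter P (drop_at i xs) = filter P xs"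
  by (metis filter_insert_at insert_at_drop_at)

lemma length_filter_drop_at_less:
  assumes "i < length xs" "P (xs ! i)"
  shows "length (filter P (drop_at i xs)) < length (filter P xs)"
proof -
  have "xs = take i xs @ xs ! i # drop (Suc i) xs" by (simp add: assms id_take_nth_drop)
  then have "length (filter P xs) = length (filter P (take i xs @ xs ! i # drop (Suc i) xs))" by simp
  then show ?thesis using assms by (simp add: drop_at_def)
qed

lemma last_take_conv_nth: "0 < t \<Longrightarrow> t < length xs \<Longrightarrow> last (take t xs) = xs ! (t - 1)"
  by (cases "take t xs = []") (auto simp: last_conv_nth min_def)

lemma distinct_adj_insert_at_iff:
  assumes "0 < t" "t < length xs" "distinct_adj xs"
  shows "distinct_adj (insert_at t g xs) \<longleftrightarrow> g \<noteq> xs ! (t - 1) \<and> g \<noteq> xs ! t"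
proof -
  have "distinct_adj (take t xs @ drop t xs)" using assms by simp
  then have "distinct_adj (take t xs)" "distinct_adj (drop t xs)" by blast+
  then show ?thesis using assms
    by (auto simp: insert_at_def distinct_adj_append_iff distinct_adj_Cons hd_drop_conv_nth last_take_conv_nth)
qed

lemma distinct_adj_insert_atD:
  assumes "0 < t" "t < length xs" "distinct_adj (insert_at t g xs)" "xs ! (t - 1) \<noteq> xs ! t"
  shows "distinct_adj xs"
proof -
  have "distinct_adj (take t xs)" "distinct_adj (drop t xs)"
    using assms by (auto simp: insert_at_def distinct_adj_append_iff distinct_adj_Cons)
  then show ?thesis
    using assms distinct_adj_append_iff[of "take t xs" "drop t xs"]
    by (simp add: hd_drop_conv_nth last_take_conv_nth)
qed

lemma exists_change:
  "\<not> list_all P ps \<Longrightarrow> \<not> list_all (\<lambda>x. \<not> P x) ps \<Longrightarrow> \<exists>m. Suc m < length ps \<and> P (ps ! m) \<noteq> P (ps ! Suc m)"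
proof (induction ps)
  case (Cons p ps)
  show ?case
  proof (cases "list_all P ps \<or> list_all (\<lambda>x. \<not> P x) ps")
    case True
    then have "ps \<noteq> []" "P p \<noteq> P (hd ps)" using Cons.prems by (cases ps; auto)+
    then show ?thesis by (intro exI[of _ 0]) (auto simp: hd_conv_nth)
  next
    case False
    then obtain m where "Suc m < length ps" "P (ps ! m) \<noteq> P (ps ! Suc m)" using Cons.IH by blast
    then show ?thesis by (intro exI[of _ "Suc m"]) auto
  qed
qed simp

text \<open>
  The position of the entry number \<open>m\<close>, counted from \<open>0\<close>, among the entries outside \<open>W\<close>; its value is
  arbitrary if there are too few such entries. Insertions and deletions of entries in \<open>W\<close> move this
  position in a predictable way, while they leave the sequence of entries outside \<open>W\<close> unchanged.
\<close>

fun pos_outside :: "'a set \<Rightarrow> nat \<Rightarrow> 'a list \<Rightarrow> nat" where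
  "pos_outside W m [] = 0"
| "pos_outside W m (x # xs) =
     (if x \<in> W then Suc (pos_outside W m xs)
      else case m of 0 \<Rightarrow> 0 | Suc m' \<Rightarrow> Suc (pos_outside W m' xs))"

lemma pos_outside_less:
  "m < length (filter (\<lambda>x. x \<notin> W) xs) \<Longrightarrow> pos_outside W m xs < length xs"
  by (induction xs arbitrary: m) (auto split: nat.split)

lemma nth_pos_outside:
  "m < length (filter (\<lambda>x. x \<notin> W) xs) \<Longrightarrow> xs ! pos_outside W m xs = filter (\<lambda>x. x \<notin> W) xs ! m"
  by (induction xs arbitrary: m) (auto split: nat.split)

lemma pos_outside_Suc_greater:
  "Suc m < length (filter (\<lambda>x. x \<notin> W) xs) \<Longrightarrow> pos_outside W m xs < pos_outside W (Suc m) xs"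
  by (induction xs arbitrary: m) (auto split: nat.split)

lemma nth_between_pos_outside:
  "\<lbrakk>Suc m < length (filter (\<lambda>x. x \<notin> W) xs); pos_outside W m xs < i; i < pos_outside W (Suc m) xs\<rbrakk>
   \<Longrightarrow> xs ! i \<in> W"
proof (induction xs arbitrary: m i)
  case (Cons x xs)
  have first: "\<And>j. 0 < length (filter (\<lambda>x. x \<notin> W) xs) \<Longrightarrow> j < pos_outside W 0 xs \<Longrightarrow> xs ! j \<in> W"
    by (induction xs) (auto simp: nth_Cons' split: if_splits)
  show ?case using Cons.prems Cons.IH first
    by (cases i) (auto split: if_splits nat.splits)
qed simp

lemma pos_outside_insert_at:
  "\<lbrakk>w \<in> W; t \<le> length xs; m < length (filter (\<lambda>x. x \<notin> W) xs)\<rbrakk> \<Longrightarrow>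
   pos_outside W m (insert_at t w xs) =
     (if t \<le> pos_outside W m xs then Suc (pos_outside W m xs) else pos_outside W m xs)"
proof (induction xs arbitrary: m t)
  case (Cons x xs)
  then show ?case
    by (cases t) (auto simp: insert_at_def split: nat.split)
qed simp

lemma pos_outside_drop_at:
  assumes "i < length xs" "xs ! i \<in> W" "m < length (filter (\<lambda>x. x \<notin> W) xs)"
  shows "pos_outside W m (drop_at i xs) =
    (if i < pos_outside W m xs then pos_outside W m xs - 1 else pos_outside W m xs)"
proof -
  have "i \<le> length (drop_at i xs)" "m < length (filter (\<lambda>x. x \<notin> W) (drop_at i xs))"
    using assms by (simp_all add: filter_drop_at)
  from pos_outside_insert_at[OF assms(2) this] show ?thesis
    using assms by (auto simp: insert_at_drop_at split: if_splits)
qed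

section \<open>Chains\<close>

lemma carrier_MC: "carrier (MC X k) = {c. Poly_Mapping.keys c \<subseteq> k_paths X k}"
  by (auto simp: MC_def free_Abelian_group_def)

lemma keys_add_subset:
  "Poly_Mapping.keys a \<subseteq> S \<Longrightarrow> Poly_Mapping.keys b \<subseteq> S \<Longrightarrow> Poly_Mapping.keys (a + b) \<subseteq> S"
  using keys_add[of a b] by blast

lemma keys_diff_subset:
  "Poly_Mapping.keys a \<subseteq> S \<Longrightarrow> Poly_Mapping.keys b \<subseteq> S \<Longrightarrow> Poly_Mapping.keys (a - b) \<subseteq> S"
  using keys_diff[of a b] by blast

lemma keys_frag_extend_subset:
  "Poly_Mapping.keys c \<subseteq> S \<Longrightarrow> (\<And>x. x \<in> S \<Longrightarrow> Poly_Mapping.keys (f x) \<subseteq> T) \<Longrightarrow>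
   Poly_Mapping.keys (frag_extend f c) \<subseteq> T"
  using keys_frag_extend[of f c] by blast

lemma keys_sum_subset:
  "(\<And>i. i \<in> A \<Longrightarrow> Poly_Mapping.keys (f i) \<subseteq> S) \<Longrightarrow> Poly_Mapping.keys (sum f A) \<subseteq> S"
  using keys_sum[of f A] by blast

lemma keys_cmul_subset: "Poly_Mapping.keys c \<subseteq> S \<Longrightarrow> Poly_Mapping.keys (frag_cmul a c) \<subseteq> S"
  using keys_cmul[of a c] by blast

lemma frag_cmul_diff: "frag_cmul c (a - b) = frag_cmul c a - frag_cmul c b"
  using frag_cmul_distrib2[of c "a - b" b] by (simp add: algebra_simps)

text \<open>
  The faces of a path with one entry inserted at \<open>t\<close>, listed by the faces of the original path:
  the indices from \<open>t\<close> on are shifted, and the face that removes the new entry is left over.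
\<close>

lemma sum_skip:
  fixes G :: "nat \<Rightarrow> 'b :: comm_monoid_add"
  assumes "0 < t" "t \<le> k"
  shows "sum G {1..<Suc k} = G t + (\<Sum>i\<in>{1..<k}. G (if i < t then i else Suc i))"
proof -
  have "sum G ({1..<Suc k} - {t}) = (\<Sum>i\<in>{1..<k}. G (if i < t then i else Suc i))"
    using assms
    by (intro sum.reindex_bij_witness[where i = "\<lambda>i. if i < t then i else Suc i" and j = "\<lambda>l. if l < t then l else l - 1"])
       (auto split: if_splits)
  then show ?thesis using assms by (subst sum.remove[of _ t]) auto
qed

lemma k_paths_mono: "A \<subseteq> B \<Longrightarrow> k_paths A k \<subseteq> k_paths B k"
  by (auto simp: k_paths_def)

lemma keys_MC_face:
  assumes "x \<in> k_paths A k" "i < Suc k" "k > 0"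
  shows "Poly_Mapping.keys (MC_face I i x) \<subseteq> k_paths A (k - 1)"
  using assms set_drop_at_subset[of i x] by (auto simp: MC_face_def k_paths_def)

lemma MC_boundary_diff: "MC_boundary I k (a - b) = MC_boundary I k a - MC_boundary I k b"
  by (simp add: MC_boundary_def frag_extend_diff)

lemma MC_boundary_add: "MC_boundary I k (a + b) = MC_boundary I k a + MC_boundary I k b"
  by (simp add: MC_boundary_def frag_extend_add)

lemma MC_boundary_minus: "MC_boundary I k (- a) = - MC_boundary I k a"
  by (simp add: MC_boundary_def frag_extend_minus)

lemma MC_boundary_zero [simp]: "MC_boundary I k 0 = 0"
  by (simp add: MC_boundary_def)

lemma MC_boundary_frag_of:
  "MC_boundary I k (frag_of x) = (\<Sum>i\<in>{1..<k}. frag_cmul ((-1) ^ i) (MC_face I i x))"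
  by (simp add: MC_boundary_def)

lemma MC_boundary_degree_0 [simp]: "MC_boundary I 0 c = 0"
  by (simp add: MC_boundary_def frag_extend_eq_0)

lemma keys_MC_boundary:
  assumes "Poly_Mapping.keys c \<subseteq> k_paths A k"
  shows "Poly_Mapping.keys (MC_boundary I k c) \<subseteq> k_paths A (k - 1)"
  unfolding MC_boundary_def
  by (rule keys_frag_extend_subset[OF assms]) (intro keys_sum_subset keys_cmul_subset keys_MC_face, auto)

lemma MC_boundary_sub_intervals:
  assumes "Poly_Mapping.keys c \<subseteq> k_paths A k"
  shows "MC_boundary (sub_intervals I A) k c = MC_boundary I k c"
  unfolding MC_boundary_def
proof (rule frag_extend_eq, rule sum.cong[OF refl])
  fix x i assume "x \<in> Poly_Mapping.keys c" "i \<in> {1..<k}"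
  then have "x ! i \<in> A" using assms by (force simp: k_paths_def intro: nth_mem)
  then show "frag_cmul ((-1) ^ i) (MC_face (sub_intervals I A) i x) = frag_cmul ((-1) ^ i) (MC_face I i x)"
    by (simp add: MC_face_def sub_intervals_def)
qed

section \<open>Chain maps from good sets\<close>

text \<open>
  A tuple with an admissible face in a good set is itself in that set. So the tuple and the
  face, which may be known to belong to two different good sets, have one in common.
\<close>

lemma good_set_max_good_set: "good_set A I J f (max_good_set A I J f)"
  unfolding good_set_def
proof (intro conjI ballI impI allI)
  show "max_good_set A I J f \<subseteq> tuples A"
    unfolding max_good_set_def good_set_def by blast
next
  fix xs i assume "xs \<in> max_good_set A I J f" and len: "2 \<le> length xs" "i < length xs"
  then obtain G where G: "good_set A I J f G" "xs \<in> G" by (auto simp: max_good_set_def)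
  show "between_at J (map f xs) i = (between_at I xs i \<and> drop_at i xs \<in> max_good_set A I J f)"
  proof
    assume "between_at J (map f xs) i"
    then have "between_at I xs i \<and> drop_at i xs \<in> G" using G len unfolding good_set_def by blast
    then show "between_at I xs i \<and> drop_at i xs \<in> max_good_set A I J f"
      using G by (auto simp: max_good_set_def)
  next
    assume *: "between_at I xs i \<and> drop_at i xs \<in> max_good_set A I J f"
    then obtain G' where G': "good_set A I J f G'" "drop_at i xs \<in> G'" by (auto simp: max_good_set_def)
    have "xs \<in> tuples A" using G unfolding good_set_def by blast
    then have "xs \<in> G'" using G' * len unfolding good_set_def by blast
    then show "between_at J (map f xs) i" using G' * len unfolding good_set_def by blast
  qed
next
  fix xs i assume xs: "xs \<in> tuples A - max_good_set A I J f" "2 \<le> length xs" "i < length xs" "between_at I xs i"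
  show "drop_at i xs \<notin> max_good_set A I J f"
  proof
    assume "drop_at i xs \<in> max_good_set A I J f"
    then obtain G where G: "good_set A I J f G" "drop_at i xs \<in> G" by (auto simp: max_good_set_def)
    then have "xs \<in> tuples A - G" using xs by (auto simp: max_good_set_def)
    then show False using G xs unfolding good_set_def by blast
  qed
qed

text \<open>
  The condition \<open>distinct_adj (map f x)\<close> reads an image with equal neighbours as \<open>0\<close>.
\<close>

definition good_map :: "'a list set \<Rightarrow> ('a \<Rightarrow> 'b) \<Rightarrow> ('a list \<Rightarrow>\<^sub>0 int) \<Rightarrow> ('b list \<Rightarrow>\<^sub>0 int)" where
  "good_map G f =
     frag_extend (\<lambda>x. if x \<in> G \<and> distinct_adj (map f x) then frag_of (map f x) else 0)"

lemma good_map_diff: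
  "good_map G f (a - b) = good_map G f a - good_map G f b"
  by (simp add: good_map_def frag_extend_diff)

lemma keys_good_map:
  assumes "f \<in> A \<rightarrow> B" "Poly_Mapping.keys c \<subseteq> k_paths A k"
  shows "Poly_Mapping.keys (good_map G f c) \<subseteq> k_paths B k"
  unfolding good_map_def
  by (rule keys_frag_extend_subset[OF assms(2)]) (use assms(1) in \<open>auto simp: k_paths_def\<close>)

lemma good_map_id:
  assumes "Poly_Mapping.keys c \<subseteq> k_paths B k" "tuples B \<subseteq> G" "\<And>w. w \<in> B \<Longrightarrow> f w = w"
  shows "good_map G f c = c"
proof -
  have "good_map G f c = frag_extend frag_of c"
    unfolding good_map_def
  proof (rule frag_extend_eq)
    fix x assume "x \<in> Poly_Mapping.keys c"
    then have x: "x \<in> k_paths B k" using assms by blast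
    then have "map f x = x" using assms(3) by (auto simp: k_paths_def intro!: map_idI)
    moreover have "x \<in> G" using x assms(2) by (auto simp: k_paths_def tuples_def)
    ultimately show "(if x \<in> G \<and> distinct_adj (map f x) then frag_of (map f x) else 0) = frag_of x"
      using x by (simp add: k_paths_def)
  qed
  then show ?thesis using frag_expansion by metis
qed

text \<open>
  If two equal neighbours of \<open>y\<close> are both interior, then removing either of them gives the same tuple,
  with opposite signs, and all other faces still contain the repetition. So the boundary formula,
  applied to the degenerate tuple \<open>y\<close>, yields \<open>0\<close>.
\<close>

lemma boundary_sum_interior_repeat:
  assumes J: "\<And>x z. x \<in> set y \<Longrightarrow> z \<in> set y \<Longrightarrow> x \<in> J x z \<and> z \<in> J x z"
    and len: "length y = Suc k" and j: "1 \<le> j" "Suc j < k" "y ! j = y ! Suc j"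
  shows "(\<Sum>i\<in>{1..<k}. frag_cmul ((-1) ^ i) (MC_face J i y)) = 0"
proof -
  let ?F = "\<lambda>i. frag_cmul ((-1) ^ i) (MC_face J i y)"
  have other: "?F i = 0" if i: "i \<in> {1..<k} - {j, Suc j}" for i
  proof -
    have "\<not> distinct_adj (drop_at i y)"
    proof (cases "i < j")
      case True
      then have "drop_at i y ! (j - 1) = drop_at i y ! Suc (j - 1)" "Suc (j - 1) < length (drop_at i y)"
        using i j len by (auto simp: nth_drop_at)
      then show ?thesis using distinct_adj_nth by blast
    next
      case False
      then have "drop_at i y ! j = drop_at i y ! Suc j" "Suc j < length (drop_at i y)"
        using i j len by (auto simp: nth_drop_at)
      then show ?thesis using distinct_adj_nth by blast
    qed
    then show ?thesis by (simp add: MC_face_def)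
  qed
  have eq: "drop_at j y = drop_at (Suc j) y"
    using j len by (intro nth_equalityI) (auto simp: nth_drop_at less_Suc_eq)
  have "y ! j \<in> J (y ! (j - 1)) (y ! (j + 1))" "y ! Suc j \<in> J (y ! (Suc j - 1)) (y ! (Suc j + 1))"
    using j len J[of "y ! (j - 1)" "y ! j"] J[of "y ! j" "y ! (Suc j + 1)"] by auto
  then have "MC_face J j y = MC_face J (Suc j) y" by (simp add: MC_face_def eq)
  then have "?F j + ?F (Suc j) = 0" by (simp flip: frag_cmul_distrib)
  moreover have "sum ?F {1..<k} = sum ?F {j, Suc j}"
    using j by (intro sum.mono_neutral_right) (auto intro!: other simp del: frag_cmul_eq_0_iff)
  ultimately show ?thesis by simp
qed

text \<open>
  For \<open>x\<close> in \<open>G\<close> the good set condition says precisely that the admissible faces of \<open>map f x\<close> are the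
  images of those admissible faces of \<open>x\<close> that stay in \<open>G\<close>; for \<open>x\<close> outside \<open>G\<close> all admissible faces
  are outside \<open>G\<close> too. It remains to treat an \<open>x\<close> in \<open>G\<close> whose image has equal neighbours. By the
  condition at the two end indices, these neighbours cannot include an end of \<open>map f x\<close>, as \<open>x\<close> has no
  equal neighbours; so they are interior and the boundary of the image cancels.
\<close>

lemma good_map_boundary:
  assumes G: "good_set A I J f G" and f: "f \<in> A \<rightarrow> B"
    and J: "\<And>x z. x \<in> B \<Longrightarrow> z \<in> B \<Longrightarrow> x \<in> J x z \<and> z \<in> J x z"
    and c: "Poly_Mapping.keys c \<subseteq> k_paths A k"
  shows "MC_boundary J k (good_map G f c) = good_map G f (MC_boundary I k c)"
  using c
proof (induction c rule: frag_induction)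
  case zero
  then show ?case by (simp add: good_map_def)
next
  case (diff a b)
  then show ?case by (simp add: MC_boundary_diff good_map_diff)
next
  case (one x)
  then have len: "length x = Suc k" and A: "set x \<subseteq> A" and da: "distinct_adj x"
    by (auto simp: k_paths_def)
  then have tup: "x \<in> tuples A" by (auto simp: tuples_def)
  let ?r = "\<lambda>x. if x \<in> G \<and> distinct_adj (map f x) then frag_of (map f x) else 0"
  have map_drop: "map f (drop_at i x) = drop_at i (map f x)" for i
    by (simp add: drop_at_def take_map drop_map)
  have face: "good_map G f (MC_face I i x) =
      (if between_at I x i \<and> drop_at i x \<in> G \<and> distinct_adj (drop_at i (map f x))
       then frag_of (drop_at i (map f x)) else 0)" if "i \<in> {1..<k}" for i
    using that len distinct_adj_mapD[of f "drop_at i x"]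
    by (auto simp: good_map_def MC_face_def between_at_def map_drop)
  have sum: "good_map G f (MC_boundary I k (frag_of x)) =
      (\<Sum>i\<in>{1..<k}. frag_cmul ((-1) ^ i) (good_map G f (MC_face I i x)))"
    by (simp add: MC_boundary_frag_of good_map_def frag_extend_sum frag_extend_cmul)
  show ?case
  proof (cases "x \<in> G")
    case False
    have "good_map G f (MC_face I i x) = 0" if i: "i \<in> {1..<k}" for i
    proof -
      have "drop_at i x \<notin> G" if "between_at I x i"
        using G False tup len i that unfolding good_set_def by auto
      then show ?thesis by (auto simp: face[OF i])
    qed
    then show ?thesis using False by (simp add: sum) (simp add: good_map_def)
  next
    case True
    have between: "between_at J (map f x) i \<longleftrightarrow> between_at I x i \<and> drop_at i x \<in> G" if "i \<le> k" "1 \<le> k" for i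
      using G True len that unfolding good_set_def by auto
    have "good_map G f (MC_face I i x) = MC_face J i (map f x)" if i: "i \<in> {1..<k}" for i
      unfolding face[OF i] using i len between[of i] by (auto simp: MC_face_def between_at_def)
    then have sum': "good_map G f (MC_boundary I k (frag_of x)) =
        (\<Sum>i\<in>{1..<k}. frag_cmul ((-1) ^ i) (MC_face J i (map f x)))"
      by (simp add: sum)
    show ?thesis
    proof (cases "distinct_adj (map f x)")
      case da': True
      then show ?thesis using True by (simp add: sum') (simp add: good_map_def MC_boundary_frag_of)
    next
      case False
      then obtain j where j: "Suc j < length x" "map f x ! j = map f x ! Suc j"
        unfolding distinct_adj_conv_nth by auto
      have "j \<noteq> 0"
      proof
        assume "j = 0"
        then have "between_at J (map f x) 0" using j by (simp add: between_at_def)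
        then have "between_at I x 0" using between[of 0] j len by simp
        then show False using distinct_adj_nth[OF da, of 0] j \<open>j = 0\<close> by (simp add: between_at_def)
      qed
      moreover have "Suc j \<noteq> k"
      proof
        assume *: "Suc j = k"
        then have "between_at J (map f x) k" using j len \<open>j \<noteq> 0\<close> by (auto simp: between_at_def)
        then have "between_at I x k" using between[of k] * by simp
        then show False using distinct_adj_nth[OF da, of j] j * len by (auto simp: between_at_def)
      qed
      moreover have "x' \<in> J x' z' \<and> z' \<in> J x' z'" if "x' \<in> set (map f x)" "z' \<in> set (map f x)" for x' z'
        using that J f A by auto
      ultimately have "good_map G f (MC_boundary I k (frag_of x)) = 0"
        unfolding sum' by (intro boundary_sum_interior_repeat[where j = j]) (use j len in auto)
      then show ?thesis using False by simp (simp add: good_map_def)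
    qed
  qed
qed

section \<open>Homology classes\<close>

text \<open>
  The coset of \<open>c\<close>, as an explicit set of chains. Since chains on \<open>A \<subseteq> X\<close> have the same boundary for the
  intervals of \<open>X\<close> and for those of \<open>A\<close>, the same set is obtained from either, so that one map \<open>I\<close> serves
  for all subspaces.
\<close>

definition homology_class ::
    "'a set \<Rightarrow> ('a \<Rightarrow> 'a \<Rightarrow> 'a set) \<Rightarrow> nat \<Rightarrow> ('a list \<Rightarrow>\<^sub>0 int) \<Rightarrow> ('a list \<Rightarrow>\<^sub>0 int) set" where
  "homology_class X I k c = {b + c | b. b \<in> MC_boundaries X I k}"

lemma subgroup_MC:
  assumes "H \<subseteq> carrier (MC X k)" "0 \<in> H" "\<And>a b. a \<in> H \<Longrightarrow> b \<in> H \<Longrightarrow> a - b \<in> H"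
  shows "subgroup H (MC X k)"
proof -
  have neg: "- a \<in> H" if "a \<in> H" for a using assms(3)[OF assms(2) that] by simp
  have "a + b \<in> H" if "a \<in> H" "b \<in> H" for a b using assms(3)[OF that(1) neg[OF that(2)]] by simp
  then show ?thesis
    using assms neg unfolding MC_def by (intro subgroup.intro) (auto simp: subset_iff)
qed

lemma subgroup_MC_cycles: "subgroup (MC_cycles X I k) (MC X k)"
  by (rule subgroup_MC) (auto simp: MC_cycles_def carrier_MC MC_boundary_diff dest: keys_diff_subset)

lemma subgroup_MC_boundaries: "subgroup (MC_boundaries X I k) (MC X k)"
proof (rule subgroup_MC)
  show "MC_boundaries X I k \<subseteq> carrier (MC X k)"
    using keys_MC_boundary[where k = "Suc k"] by (auto simp: MC_boundaries_def carrier_MC)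
  show "0 \<in> MC_boundaries X I k"
    by (auto simp: MC_boundaries_def carrier_MC intro!: image_eqI[where x = 0])
  fix a b assume "a \<in> MC_boundaries X I k" "b \<in> MC_boundaries X I k"
  then obtain d e where "Poly_Mapping.keys d \<subseteq> k_paths X (Suc k)" "Poly_Mapping.keys e \<subseteq> k_paths X (Suc k)"
      "a = MC_boundary I (Suc k) d" "b = MC_boundary I (Suc k) e"
    by (auto simp: MC_boundaries_def carrier_MC)
  then show "a - b \<in> MC_boundaries X I k"
    using keys_diff_subset[of d "k_paths X (Suc k)" e]
    by (auto simp: MC_boundaries_def carrier_MC MC_boundary_diff intro!: image_eqI[where x = "d - e"])
qed

lemma MC_boundaries_closed:
  "0 \<in> MC_boundaries X I k"
  "a \<in> MC_boundaries X I k \<Longrightarrow> b \<in> MC_boundaries X I k \<Longrightarrow> a + b \<in> MC_boundaries X I k"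
  "a \<in> MC_boundaries X I k \<Longrightarrow> - a \<in> MC_boundaries X I k"
  "a \<in> MC_boundaries X I k \<Longrightarrow> b \<in> MC_boundaries X I k \<Longrightarrow> a - b \<in> MC_boundaries X I k"
proof -
  show 0: "0 \<in> MC_boundaries X I k"
    using subgroup.one_closed[OF subgroup_MC_boundaries] by (simp add: MC_def)
  show add: "a + b \<in> MC_boundaries X I k" if "a \<in> MC_boundaries X I k" "b \<in> MC_boundaries X I k" for a b
    using subgroup.m_closed[OF subgroup_MC_boundaries that] by (simp add: MC_def)
  show minus: "- a \<in> MC_boundaries X I k" if "a \<in> MC_boundaries X I k" for a
  proof -
    have "Poly_Mapping.keys a \<subseteq> k_paths X k"
      using subsetD[OF subgroup.subset[OF subgroup_MC_boundaries] that] by (simp add: carrier_MC)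
    then show ?thesis
      using subgroup.m_inv_closed[OF subgroup_MC_boundaries that] by (simp add: MC_def)
  qed
  show "a - b \<in> MC_boundaries X I k" if "a \<in> MC_boundaries X I k" "b \<in> MC_boundaries X I k" for a b
    using add[OF that(1) minus[OF that(2)]] by simp
qed

lemma homology_class_eq_iff:
  "homology_class X I k c = homology_class X I k d \<longleftrightarrow> c - d \<in> MC_boundaries X I k"
proof
  assume "homology_class X I k c = homology_class X I k d"
  moreover have "c \<in> homology_class X I k c"
    using MC_boundaries_closed(1)[of X I k] by (force simp: homology_class_def)
  ultimately show "c - d \<in> MC_boundaries X I k" by (auto simp: homology_class_def)
next
  assume *: "c - d \<in> MC_boundaries X I k"
  show "homology_class X I k c = homology_class X I k d"
  proof (intro equalityI subsetI)
    fix u assume "u \<in> homology_class X I k c"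
    then obtain b where "u = (b + (c - d)) + d" "b \<in> MC_boundaries X I k" by (auto simp: homology_class_def)
    then show "u \<in> homology_class X I k d"
      using MC_boundaries_closed(2)[OF _ *] unfolding homology_class_def by blast
  next
    fix u assume "u \<in> homology_class X I k d"
    then obtain b where "u = (b - (c - d)) + c" "b \<in> MC_boundaries X I k" by (auto simp: homology_class_def)
    then show "u \<in> homology_class X I k c"
      using MC_boundaries_closed(4)[OF _ *] unfolding homology_class_def by blast
  qed
qed

lemma mult_MH_homology_class:
  "homology_class X I k c \<otimes>\<^bsub>MH X I k\<^esub> homology_class X I k d = homology_class X I k (c + d)"
proof -
  have "homology_class X I k c \<otimes>\<^bsub>MH X I k\<^esub> homology_class X I k d =
      {u + v | u v. u \<in> homology_class X I k c \<and> v \<in> homology_class X I k d}"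
    by (auto simp: MH_def set_mult_def MC_def)
  also have "\<dots> = homology_class X I k (c + d)"
  proof (intro equalityI subsetI)
    fix w assume "w \<in> {u + v | u v. u \<in> homology_class X I k c \<and> v \<in> homology_class X I k d}"
    then obtain a b where "a \<in> MC_boundaries X I k" "b \<in> MC_boundaries X I k" "w = (a + b) + (c + d)"
      by (auto simp: homology_class_def)
    then show "w \<in> homology_class X I k (c + d)"
      using MC_boundaries_closed(2) unfolding homology_class_def by blast
  next
    fix w assume "w \<in> homology_class X I k (c + d)"
    then obtain a where "a \<in> MC_boundaries X I k" "w = (a + c) + (0 + d)"
      by (auto simp: homology_class_def)
    then show "w \<in> {u + v | u v. u \<in> homology_class X I k c \<and> v \<in> homology_class X I k d}"
      using MC_boundaries_closed(1) unfolding homology_class_def by blast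
  qed
  finally show ?thesis .
qed

lemma one_MH: "\<one>\<^bsub>MH X I k\<^esub> = homology_class X I k 0"
  by (auto simp: MH_def homology_class_def)

lemma carrier_MH: "carrier (MH X I k) = homology_class X I k ` MC_cycles X I k"
proof -
  have "carrier (subgroup_generated (MC X k) (MC_cycles X I k)) = MC_cycles X I k"
    using subgroup.carrier_subgroup_generated_subgroup[OF subgroup_MC_cycles] by (simp add: MC_def)
  then show ?thesis
    by (auto simp: MH_def carrier_FactGroup r_coset_def homology_class_def MC_def image_iff)
qed

lemma MH_incl_homology_class:
  assumes "A \<subseteq> X"
  shows "MH_incl X I k (homology_class A (sub_intervals I A) k c) = homology_class X I k c"
proof -
  have sub: "MC_boundaries A (sub_intervals I A) k \<subseteq> MC_boundaries X I k"
  proof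
    fix b assume "b \<in> MC_boundaries A (sub_intervals I A) k"
    then obtain e where e: "Poly_Mapping.keys e \<subseteq> k_paths A (Suc k)" "b = MC_boundary I (Suc k) e"
      by (auto simp: MC_boundaries_def carrier_MC MC_boundary_sub_intervals)
    moreover have "k_paths A (Suc k) \<subseteq> k_paths X (Suc k)" using assms by (auto simp: k_paths_def)
    ultimately show "b \<in> MC_boundaries X I k" by (auto simp: MC_boundaries_def carrier_MC)
  qed
  have "MH_incl X I k (homology_class A (sub_intervals I A) k c) =
      {u + v | u v. u \<in> MC_boundaries X I k \<and> v \<in> homology_class A (sub_intervals I A) k c}"
    by (auto simp: MH_incl_def set_mult_def MC_def)
  also have "\<dots> = homology_class X I k c"
  proof (intro equalityI subsetI)
    fix w assume "w \<in> {u + v | u v. u \<in> MC_boundaries X I k \<and> v \<in> homology_class A (sub_intervals I A) k c}"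
    then obtain a b where "a \<in> MC_boundaries X I k" "b \<in> MC_boundaries X I k" "w = (a + b) + c"
      using sub by (auto simp: homology_class_def add.assoc)
    then show "w \<in> homology_class X I k c"
      using MC_boundaries_closed(2) unfolding homology_class_def by blast
  next
    fix w assume "w \<in> homology_class X I k c"
    then obtain a where "a \<in> MC_boundaries X I k" "w = a + (0 + c)"
      by (auto simp: homology_class_def)
    then show "w \<in> {u + v | u v. u \<in> MC_boundaries X I k \<and> v \<in> homology_class A (sub_intervals I A) k c}"
      using MC_boundaries_closed(1) unfolding homology_class_def by blast
  qed
  finally show ?thesis .
qed

lemma comm_group_MH:
  assumes "MC_boundaries X I k \<subseteq> MC_cycles X I k"
  shows "comm_group (MH X I k)"
proof -
  have comm: "comm_group (MC X k)" and grp: "group (MC X k)"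
    by (simp_all add: MC_def abelian_free_Abelian_group)
  have "subgroup (MC_boundaries X I k) (subgroup_generated (MC X k) (MC_cycles X I k))"
    using group.subgroup_of_subgroup_generated[OF grp] assms subgroup_MC_boundaries by blast
  then show ?thesis
    unfolding MH_def
    using comm_group.abelian_FactGroup group.abelian_subgroup_generated[OF grp comm] by blast
qed

lemma inv_MH_homology_class:
  assumes "comm_group (MH X I k)" "c \<in> MC_cycles X I k"
  shows "inv\<^bsub>MH X I k\<^esub> (homology_class X I k c) = homology_class X I k (- c)"
proof (rule group.inv_equality)
  show "group (MH X I k)" using assms(1) by (simp add: comm_group_def)
  show "homology_class X I k (- c) \<otimes>\<^bsub>MH X I k\<^esub> homology_class X I k c = \<one>\<^bsub>MH X I k\<^esub>"
    by (simp add: mult_MH_homology_class one_MH)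
  have "- c \<in> MC_cycles X I k" using assms(2) by (simp add: MC_cycles_def carrier_MC MC_boundary_minus)
  then show "homology_class X I k c \<in> carrier (MH X I k)" "homology_class X I k (- c) \<in> carrier (MH X I k)"
    using assms(2) by (auto simp: carrier_MH)
qed

lemma sub_intervals_sub_intervals: "B \<subseteq> A \<Longrightarrow> sub_intervals (sub_intervals I A) B = sub_intervals I B"
  by (auto simp: sub_intervals_def fun_eq_iff)

lemma MC_boundaries_sub_intervals: "MC_boundaries A (sub_intervals I A) k = MC_boundaries A I k"
  by (force simp: MC_boundaries_def carrier_MC MC_boundary_sub_intervals image_iff)

lemma MC_cycles_sub_intervals: "MC_cycles A (sub_intervals I A) k = MC_cycles A I k"
  by (auto simp: MC_cycles_def carrier_MC MC_boundary_sub_intervals)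

lemma homology_class_sub_intervals: "homology_class A (sub_intervals I A) k c = homology_class A I k c"
  by (simp add: homology_class_def MC_boundaries_sub_intervals)

lemma MC_boundaries_subset_cycles:
  assumes "\<And>n c. c \<in> carrier (MC X (Suc (Suc n))) \<Longrightarrow> MC_boundary I (Suc n) (MC_boundary I (Suc (Suc n)) c) = 0"
    and "A \<subseteq> X"
  shows "MC_boundaries A I k \<subseteq> MC_cycles A I k"
proof
  fix b assume "b \<in> MC_boundaries A I k"
  then obtain e where e: "Poly_Mapping.keys e \<subseteq> k_paths A (Suc k)" "b = MC_boundary I (Suc k) e"
    by (auto simp: MC_boundaries_def carrier_MC)
  have "Poly_Mapping.keys e \<subseteq> k_paths X (Suc k)" using order_trans[OF e(1) k_paths_mono[OF assms(2)]] .
  then have "MC_boundary I k b = 0"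
    using assms(1)[of e "k - 1"] e(2) by (cases k) (auto simp: carrier_MC)
  then show "b \<in> MC_cycles A I k"
    using keys_MC_boundary[OF e(1), of I] e(2) by (simp add: MC_cycles_def carrier_MC)
qed

lemma comm_group_DirProd:
  assumes "comm_group G" "comm_group H"
  shows "comm_group (G \<times>\<times> H)"
proof (rule group.group_comm_groupI)
  interpret G: comm_group G by fact
  interpret H: comm_group H by fact
  show "group (G \<times>\<times> H)" by (simp add: DirProd_group)
  show "\<And>x y. x \<in> carrier (G \<times>\<times> H) \<Longrightarrow> y \<in> carrier (G \<times>\<times> H) \<Longrightarrow> x \<otimes>\<^bsub>G \<times>\<times> H\<^esub> y = y \<otimes>\<^bsub>G \<times>\<times> H\<^esub> x"
    by (auto simp: G.m_comm H.m_comm)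
qed

section \<open>Inserting gates into mixed paths\<close>

locale gated_space =
  fixes X Y Z W :: "'a set" and I :: "'a \<Rightarrow> 'a \<Rightarrow> 'a set" and \<pi> :: "'a \<Rightarrow> 'a"
  assumes space: "betweenness_space X I"
    and X: "X = Y \<union> Z" and W: "W = Y \<inter> Z"
    and gate_mem: "z \<in> Z \<Longrightarrow> \<pi> z \<in> W"
    and gate_between: "z \<in> Z \<Longrightarrow> y \<in> Y \<Longrightarrow> \<pi> z \<in> I z y"
    and gate_between_rev: "z \<in> Z \<Longrightarrow> y \<in> Y \<Longrightarrow> \<pi> z \<in> I y z"
begin

lemma W_subset: "W \<subseteq> X" "W \<subseteq> Y" "W \<subseteq> Z"
  using W X by auto

lemma interval_subset:
  "x \<in> X \<Longrightarrow> z \<in> X \<Longrightarrow> y \<in> I x z \<Longrightarrow> I x y \<subseteq> I x z"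
  "x \<in> X \<Longrightarrow> z \<in> X \<Longrightarrow> y \<in> I x z \<Longrightarrow> I y z \<subseteq> I x z"
  using space unfolding betweenness_space_def by blast+

lemma interval_exchange:
  "x \<in> X \<Longrightarrow> z \<in> X \<Longrightarrow> w \<in> I x z \<Longrightarrow> y \<in> I x z \<Longrightarrow> w \<in> I x y \<longleftrightarrow> y \<in> I w z"
  using space unfolding betweenness_space_def by blast

text \<open>
  Replacing \<open>z\<close> by its gate does not change which points of \<open>Y\<close> are between it and a given point of \<open>Y\<close>.
  One direction is monotonicity of intervals. The other is the exchange axiom
  in the interval from \<open>z\<close> to \<open>v\<close>, which contains both \<open>w\<close> and the gate: as the gate is between \<open>z\<close> and
  \<open>w\<close>, the point \<open>w\<close> is between the gate and \<open>v\<close>.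
\<close>

lemma between_from_gate_iff:
  assumes "z \<in> Z" "w \<in> Y" "v \<in> Y"
  shows "w \<in> I (\<pi> z) v \<longleftrightarrow> w \<in> I z v"
proof -
  have X: "z \<in> X" "v \<in> X" using assms X by auto
  note gz = gate_between[OF assms(1,3)] gate_between[OF assms(1,2)]
  show ?thesis
    using interval_subset(2)[OF X gz(1)] interval_exchange[OF X gz(1)] gz(2) by blast
qed

lemma between_to_gate_iff:
  assumes "z \<in> Z" "w \<in> Y" "v \<in> Y"
  shows "w \<in> I v (\<pi> z) \<longleftrightarrow> w \<in> I v z"
proof -
  have X: "v \<in> X" "z \<in> X" using assms X by auto
  note gz = gate_between_rev[OF assms(1,3)] gate_between_rev[OF assms(1,2)]
  show ?thesis
    using interval_subset(1)[OF X gz(1)] interval_exchange[OF X _ gz(1)] gz(2) by blast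
qed

abbreviation outside :: "'a list \<Rightarrow> 'a list" where
  "outside \<equiv> filter (\<lambda>x. x \<notin> W)"

definition mixed :: "'a list \<Rightarrow> bool" where
  "mixed x \<longleftrightarrow> \<not> set x \<subseteq> Y \<and> \<not> set x \<subseteq> Z"

text \<open>
  A place where the path, with its entries in \<open>W\<close> ignored, changes sides: entry number \<open>switch x\<close> and the
  next one are on different sides. (Outside \<open>W\<close> a point of \<open>X\<close> is in exactly one of \<open>Y\<close> and \<open>Z\<close>.)
  Any choice will do, as long as it depends only on the entries outside \<open>W\<close>: it is then
  the same for all faces that remove an entry in \<open>W\<close>.
\<close>

definition switch :: "'a list \<Rightarrow> nat" where
  "switch x = (SOME m. Suc m < length (outside x) \<and> (outside x ! m \<in> Z \<longleftrightarrow> outside x ! Suc m \<in> Y))"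

definition gate :: "'a list \<Rightarrow> 'a" where
  "gate x = \<pi> (if outside x ! switch x \<in> Z then outside x ! switch x else outside x ! Suc (switch x))"

text \<open>
  The gate is inserted directly after the point of \<open>Z\<close> if the path leaves \<open>Z\<close> at the switch, and
  directly before it if the path enters \<open>Z\<close>.
\<close>

definition slot :: "'a list \<Rightarrow> nat" where
  "slot x = (if outside x ! switch x \<in> Z then Suc (pos_outside W (switch x) x)
     else pos_outside W (Suc (switch x)) x)"

definition insert_gate :: "'a list \<Rightarrow> 'a list" where
  "insert_gate x = insert_at (slot x) (gate x) x"

lemma mixed_outside: "set x \<subseteq> X \<Longrightarrow> mixed x \<longleftrightarrow> mixed (outside x)"
  using W X by (auto simp: mixed_def)

lemma mixed_cong: "set x \<subseteq> X \<Longrightarrow> set x' \<subseteq> X \<Longrightarrow> outside x = outside x' \<Longrightarrow> mixed x = mixed x'"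
  using mixed_outside by metis

lemma switch:
  assumes "mixed x" "set x \<subseteq> X"
  shows "Suc (switch x) < length (outside x)"
    "outside x ! switch x \<in> Z - Y \<and> outside x ! Suc (switch x) \<in> Y - Z \<or>
     outside x ! switch x \<in> Y - Z \<and> outside x ! Suc (switch x) \<in> Z - Y"
proof -
  have side: "v \<in> Z \<longleftrightarrow> v \<notin> Y" if "v \<in> set (outside x)" for v
    using that assms(2) X W by auto
  have "\<not> list_all (\<lambda>v. v \<in> Y) (outside x)" "\<not> list_all (\<lambda>v. v \<notin> Y) (outside x)"
    using assms side mixed_outside[OF assms(2)] by (auto simp: list_all_iff mixed_def)
  then obtain m where m: "Suc m < length (outside x)" "(outside x ! m \<in> Y) \<noteq> (outside x ! Suc m \<in> Y)"
    using exists_change[of "\<lambda>v. v \<in> Y" "outside x"] by auto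
  then have "Suc m < length (outside x) \<and> (outside x ! m \<in> Z \<longleftrightarrow> outside x ! Suc m \<in> Y)"
    using side[of "outside x ! m"] nth_mem[of m "outside x"] by auto
  then have *: "Suc (switch x) < length (outside x) \<and>
      (outside x ! switch x \<in> Z \<longleftrightarrow> outside x ! Suc (switch x) \<in> Y)"
    unfolding switch_def by (rule someI)
  then show "Suc (switch x) < length (outside x)" by simp
  show "outside x ! switch x \<in> Z - Y \<and> outside x ! Suc (switch x) \<in> Y - Z \<or>
     outside x ! switch x \<in> Y - Z \<and> outside x ! Suc (switch x) \<in> Z - Y"
    using * side[of "outside x ! switch x"] side[of "outside x ! Suc (switch x)"]
      nth_mem[of "switch x" "outside x"] nth_mem[of "Suc (switch x)" "outside x"] by auto
qed

text \<open>
  The entry opposite to \<open>z\<close> across the slot is in \<open>Y\<close>, and if it is in \<open>W\<close>, the entry beyond it is in \<open>Y\<close>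
  as well: between the two entries outside \<open>W\<close> that form the switch there are only points of \<open>W\<close>.
  These are the only entries to which the gate property is applied.
\<close>

lemma slot_cases [consumes 2, case_names leave enter]:
  assumes "mixed x" "set x \<subseteq> X"
  obtains
    "0 < slot x" "slot x < length x" "outside x ! switch x \<in> Z"
    "x ! (slot x - 1) \<in> Z - Y" "gate x = \<pi> (x ! (slot x - 1))"
    "x ! slot x \<in> Y" "x ! slot x \<in> W \<Longrightarrow> Suc (slot x) < length x \<and> x ! Suc (slot x) \<in> Y"
  | "0 < slot x" "slot x < length x" "outside x ! switch x \<notin> Z"
    "x ! slot x \<in> Z - Y" "gate x = \<pi> (x ! slot x)"
    "x ! (slot x - 1) \<in> Y" "x ! (slot x - 1) \<in> W \<Longrightarrow> 1 < slot x \<and> x ! (slot x - 2) \<in> Y"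
proof -
  let ?m = "switch x"
  define p where "p = pos_outside W ?m x"
  define q where "q = pos_outside W (Suc ?m) x"
  note sw = switch[OF assms]
  have pq: "p < q" "q < length x" unfolding p_def q_def
    using pos_outside_Suc_greater[OF sw(1)] pos_outside_less[OF sw(1)] by auto
  have x: "x ! p = outside x ! ?m" "x ! q = outside x ! Suc ?m"
    unfolding p_def q_def using nth_pos_outside sw(1) Suc_lessD by blast+
  have inW: "x ! i \<in> W" if "p < i" "i < q" for i
    using nth_between_pos_outside[OF sw(1)] that unfolding p_def q_def by blast
  from sw(2) show thesis
  proof
    assume z: "outside x ! ?m \<in> Z - Y \<and> outside x ! Suc ?m \<in> Y - Z"
    then have s: "slot x = Suc p" "gate x = \<pi> (x ! p)" by (auto simp: slot_def gate_def p_def x[unfolded p_def])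
    have Y: "x ! i \<in> Y" if "p < i" "i \<le> q" for i
      using inW[of i] that z x W by (cases "i = q") auto
    have next_W: "Suc (Suc p) < length x \<and> x ! Suc (Suc p) \<in> Y" if "x ! Suc p \<in> W"
    proof -
      have "Suc p \<noteq> q" using that z x W_subset by auto
      then show ?thesis using pq Y[of "Suc (Suc p)"] by auto
    qed
    have "x ! Suc p \<in> Y" using Y pq by simp
    then show thesis
      using pq z s x next_W by (intro that(1)) simp_all
  next
    assume z: "outside x ! ?m \<in> Y - Z \<and> outside x ! Suc ?m \<in> Z - Y"
    then have s: "slot x = q" "gate x = \<pi> (x ! q)" by (auto simp: slot_def gate_def q_def x[unfolded q_def])
    have Y: "x ! i \<in> Y" if "p \<le> i" "i < q" for i
      using inW[of i] that z x W by (cases "i = p") auto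
    have prev_W: "1 < q \<and> x ! (q - 2) \<in> Y" if "x ! (q - 1) \<in> W"
    proof -
      have "p \<noteq> q - 1" using that z x W_subset by auto
      then show ?thesis using pq Y[of "q - 2"] by auto
    qed
    have "x ! (q - 1) \<in> Y" using Y pq by simp
    then show thesis
      using pq z s x prev_W by (intro that(2)) simp_all
  qed
qed

lemma slot_bounds: "mixed x \<Longrightarrow> set x \<subseteq> X \<Longrightarrow> 0 < slot x \<and> slot x < length x"
  by (erule (1) slot_cases) auto

lemma gate_in_W: "mixed x \<Longrightarrow> set x \<subseteq> X \<Longrightarrow> gate x \<in> W"
  by (erule (1) slot_cases) (auto simp: gate_mem)

lemma switch_cong: "outside x = outside x' \<Longrightarrow> switch x = switch x'"
  by (simp add: switch_def)

lemma gate_cong: "outside x = outside x' \<Longrightarrow> gate x = gate x'"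
  using switch_cong[of x x'] by (simp add: gate_def)

lemma outside_drop_at: "i < length x \<Longrightarrow> x ! i \<in> W \<Longrightarrow> outside (drop_at i x) = outside x"
  by (simp add: filter_drop_at)

lemma outside_insert_gate: "mixed x \<Longrightarrow> set x \<subseteq> X \<Longrightarrow> outside (insert_gate x) = outside x"
  by (simp add: insert_gate_def filter_insert_at gate_in_W)

lemma slot_drop_at:
  assumes "mixed x" "set x \<subseteq> X" "i < length x" "x ! i \<in> W"
  shows "slot (drop_at i x) = (if i < slot x then slot x - 1 else slot x)"
proof -
  let ?m = "switch x"
  note sw = switch[OF assms(1,2)]
  note o = outside_drop_at[OF assms(3,4)]
  have "x ! pos_outside W ?m x \<notin> W" "x ! pos_outside W (Suc ?m) x \<notin> W"
    using nth_mem[of ?m "outside x"] nth_mem[of "Suc ?m" "outside x"] sw(1)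
    by (auto simp: nth_pos_outside)
  then have ne: "i \<noteq> pos_outside W ?m x" "i \<noteq> pos_outside W (Suc ?m) x" using assms(4) by auto
  show ?thesis
    using ne sw(1) pos_outside_drop_at[OF assms(3,4), of ?m] pos_outside_drop_at[OF assms(3,4), of "Suc ?m"]
    by (simp add: slot_def o switch_cong[OF o])
qed

lemma set_insert_gate: "mixed x \<Longrightarrow> set x \<subseteq> X \<Longrightarrow> set (insert_gate x) \<subseteq> X"
  using gate_in_W[of x] W_subset by (auto simp: insert_gate_def)

lemma length_insert_gate [simp]: "length (insert_gate x) = Suc (length x)"
  by (simp add: insert_gate_def)

text \<open>
  The second insertion happens at the same switch, so it puts the gate next to itself.
\<close>

lemma insert_gate_twice:
  assumes "mixed x" "set x \<subseteq> X"
  shows "\<not> distinct_adj (insert_gate (insert_gate x))"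
proof -
  let ?m = "switch x" and ?x = "insert_gate x"
  note sw = switch[OF assms] and o = outside_insert_gate[OF assms]
  note b = slot_bounds[OF assms]
  have pos: "pos_outside W m ?x = (if slot x \<le> pos_outside W m x then Suc (pos_outside W m x) else pos_outside W m x)"
    if "m < length (outside x)" for m
    unfolding insert_gate_def using pos_outside_insert_at[OF gate_in_W[OF assms], of "slot x" x m] b that by simp
  have sl: "slot ?x = (if outside x ! ?m \<in> Z then slot x else Suc (slot x))"
    using pos[of ?m] pos[of "Suc ?m"] sw(1) by (auto simp: slot_def o switch_cong[OF o])
  have g: "gate ?x = gate x" using gate_cong[OF o] .
  have "insert_gate ?x ! slot x = insert_gate ?x ! Suc (slot x)"
    unfolding insert_gate_def[of ?x] g sl using b
    by (auto simp: nth_insert_at) (auto simp: insert_gate_def nth_insert_at)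
  then show ?thesis
    using distinct_adj_nth[of "insert_gate ?x" "slot x"] b by auto
qed

lemma distinct_adj_insert_gateD:
  assumes "mixed x" "set x \<subseteq> X" "distinct_adj (insert_gate x)"
  shows "distinct_adj x"
proof -
  have "x ! (slot x - 1) \<noteq> x ! slot x" using assms(1,2) by (cases rule: slot_cases) auto
  then show ?thesis
    using assms(3) slot_bounds[OF assms(1,2)] distinct_adj_insert_atD[of "slot x" x "gate x"]
    by (simp add: insert_gate_def)
qed

text \<open>
  If inserting the gate creates equal neighbours, the gate is already present at the slot, and
  the path arises by insertion from the path without it.
\<close>

lemma insert_gate_or_inserted:
  assumes "mixed x" "set x \<subseteq> X" "distinct_adj x" "\<not> distinct_adj (insert_gate x)"
  obtains u where "mixed u" "set u \<subseteq> X" "insert_gate u = x"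
proof -
  have eq: "gate x = x ! (slot x - 1) \<or> gate x = x ! slot x"
    using assms distinct_adj_insert_at_iff[of "slot x" x "gate x"] slot_bounds[OF assms(1,2)]
    by (auto simp: insert_gate_def)
  have "\<exists>i. i < length x \<and> x ! i = gate x \<and> (slot x = i \<or> slot x = Suc i)"
    using assms(1,2)
  proof (cases rule: slot_cases)
    case leave
    then have "gate x \<noteq> x ! (slot x - 1)" using gate_in_W[OF assms(1,2)] W_subset by auto
    then show ?thesis using eq leave(2) by (intro exI[of _ "slot x"]) simp
  next
    case enter
    then have "gate x \<noteq> x ! slot x" using gate_in_W[OF assms(1,2)] W_subset by auto
    then show ?thesis using eq enter(1,2) by (intro exI[of _ "slot x - 1"]) simp
  qed
  then obtain i where i: "i < length x" "x ! i = gate x" "slot x = i \<or> slot x = Suc i" by blast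
  have iW: "x ! i \<in> W" using i gate_in_W[OF assms(1,2)] by simp
  let ?u = "drop_at i x"
  have X': "set ?u \<subseteq> X" using order_trans[OF set_drop_at_subset assms(2)] .
  note o = outside_drop_at[OF i(1) iW]
  have "slot ?u = i" using slot_drop_at[OF assms(1,2) i(1) iW] i(3) by auto
  then have "insert_gate ?u = x"
    using gate_cong[OF o] i insert_at_drop_at[of i x] by (simp add: insert_gate_def)
  moreover have "mixed ?u" using mixed_cong[OF X' assms(2) o] assms(1) by simp
  ultimately show thesis using X' by (intro that)
qed

lemma insert_gate_drop_at:
  assumes "mixed x" "set x \<subseteq> X" "i < length x" "x ! i \<in> W"
  shows "insert_gate (drop_at i x) =
    (if i < slot x then drop_at i (insert_gate x) else drop_at (Suc i) (insert_gate x))"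
  using slot_drop_at[OF assms] gate_cong[OF outside_drop_at[OF assms(3,4)]] slot_bounds[OF assms(1,2)] assms(3)
  by (auto simp: insert_gate_def drop_at_insert_at_before drop_at_insert_at_after)

text \<open>
  Inserting the gate does not affect whether an entry in \<open>W\<close> can be removed. This needs an argument only
  for the entry next to the gate, one of whose neighbours changes from \<open>z\<close> to the gate; the entry on
  the other side of the slot is \<open>z\<close> itself and thus not in \<open>W\<close>.
\<close>

lemma between_insert_gate:
  assumes "mixed x" "set x \<subseteq> X" "0 < i" "Suc i < length x" "x ! i \<in> W"
  defines "j \<equiv> if i < slot x then i else Suc i"
  shows "insert_gate x ! j \<in> I (insert_gate x ! (j - 1)) (insert_gate x ! (j + 1)) \<longleftrightarrow>
         x ! i \<in> I (x ! (i - 1)) (x ! (i + 1))"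
proof -
  let ?t = "slot x"
  note b = slot_bounds[OF assms(1,2)]
  have nth: "insert_gate x ! l = (if l < ?t then x ! l else if l = ?t then gate x else x ! (l - 1))"
    if "l \<le> length x" for l
    unfolding insert_gate_def using nth_insert_at[of "slot x" x l "gate x"] that b by simp
  from assms(1,2) show ?thesis
  proof (cases rule: slot_cases)
    case leave
    then have "i \<noteq> ?t - 1" using assms W by auto
    then consider "Suc i < ?t" | "i = ?t" | "?t < i" using leave(1) by linarith
    then show ?thesis
    proof cases
      case 2
      then have "x ! i \<in> Y" "x ! (i + 1) \<in> Y" using leave assms by auto
      then show ?thesis
        using between_from_gate_iff[of "x ! (i - 1)" "x ! i" "x ! (i + 1)"] leave 2 assms(4) by (simp add: j_def nth)
    qed (use assms(3,4) in \<open>auto simp: j_def nth\<close>)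
  next
    case enter
    then have "i \<noteq> ?t" using assms W by auto
    then consider "Suc i < ?t" | "i = ?t - 1" | "?t < i" using enter(1) by linarith
    then show ?thesis
    proof cases
      case 2
      then have "x ! i \<in> Y" "x ! (i - 1) \<in> Y" using enter assms by (auto simp: numeral_2_eq_2)
      then show ?thesis
        using between_to_gate_iff[of "x ! (i + 1)" "x ! i" "x ! (i - 1)"] enter 2 assms(3,4) by (simp add: j_def nth)
    qed (use assms(3,4) in \<open>auto simp: j_def nth\<close>)
  qed
qed

section \<open>The contracting homotopy\<close>

text \<open>
  For \<open>n = 0\<close> these are the paths in \<open>Y\<close> or in \<open>Z\<close>; increasing \<open>n\<close> gives a filtration of the quotient
  of the chains on \<open>X\<close> by the chains on those.
\<close>

definition lower :: "nat \<Rightarrow> nat \<Rightarrow> 'a list set" where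
  "lower n k = {x \<in> k_paths X k. mixed x \<longrightarrow> length (outside x) < n}"

definition insertion :: "'a list \<Rightarrow> ('a list \<Rightarrow>\<^sub>0 int)" where
  "insertion x = (if mixed x \<and> distinct_adj (insert_gate x)
     then frag_cmul ((-1) ^ slot x) (frag_of (insert_gate x)) else 0)"

abbreviation homotopy :: "('a list \<Rightarrow>\<^sub>0 int) \<Rightarrow> ('a list \<Rightarrow>\<^sub>0 int)" where
  "homotopy \<equiv> frag_extend insertion"

lemma lower_mono: "m \<le> n \<Longrightarrow> lower m k \<subseteq> lower n k"
  by (auto simp: lower_def)

lemma insert_gate_k_path:
  "x \<in> k_paths X k \<Longrightarrow> mixed x \<Longrightarrow> distinct_adj (insert_gate x) \<Longrightarrow> insert_gate x \<in> k_paths X (Suc k)"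
  using set_insert_gate[of x] by (simp add: k_paths_def)

lemma keys_insertion:
  assumes "x \<in> lower n k"
  shows "Poly_Mapping.keys (insertion x) \<subseteq> lower n (Suc k)"
proof (cases "mixed x \<and> distinct_adj (insert_gate x)")
  case True
  have x: "x \<in> k_paths X k" "set x \<subseteq> X" using assms by (auto simp: lower_def k_paths_def)
  then have "insert_gate x \<in> lower n (Suc k)"
    using insert_gate_k_path[OF x(1)] True outside_insert_gate[OF _ x(2)] assms by (simp add: lower_def)
  then show ?thesis using True by (auto simp: insertion_def)
qed (auto simp: insertion_def)

lemma keys_homotopy:
  "Poly_Mapping.keys c \<subseteq> lower n k \<Longrightarrow> Poly_Mapping.keys (homotopy c) \<subseteq> lower n (Suc k)"
  by (rule keys_frag_extend_subset[OF _ keys_insertion])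

lemma keys_homotopy_k_paths:
  assumes "Poly_Mapping.keys c \<subseteq> k_paths X k"
  shows "Poly_Mapping.keys (homotopy c) \<subseteq> k_paths X (Suc k)"
  by (rule keys_frag_extend_subset[OF assms]) (auto simp: insertion_def intro: insert_gate_k_path)

lemma homotopy_unmixed: "Poly_Mapping.keys c \<subseteq> lower 0 k \<Longrightarrow> homotopy c = 0"
  by (rule frag_extend_eq_0) (auto simp: lower_def insertion_def)

lemma homotopy_homotopy:
  assumes "Poly_Mapping.keys c \<subseteq> k_paths X k"
  shows "homotopy (homotopy c) = 0"
  using assms
proof (induction c rule: frag_induction)
  case (one x)
  then show ?case
    using insert_gate_twice[of x] by (auto simp: k_paths_def insertion_def frag_extend_cmul)
qed (auto simp: frag_extend_diff)

lemma mixed_mono: "set y \<subseteq> set x \<Longrightarrow> mixed y \<Longrightarrow> mixed x"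
  by (auto simp: mixed_def)

lemma keys_face_lower:
  assumes "x \<in> lower n k" "0 < i" "i < k"
  shows "Poly_Mapping.keys (MC_face I i x) \<subseteq> lower n (k - 1)"
proof -
  have x: "x \<in> k_paths X k" "length x = Suc k" using assms by (auto simp: lower_def k_paths_def)
  have "length (outside (drop_at i x)) \<le> length (outside x)"
    using length_filter_drop_at_less[of i x "\<lambda>x. x \<notin> W"] filter_drop_at[of i x "\<lambda>x. x \<notin> W"] assms x
    by (cases "x ! i \<in> W") auto
  moreover have "mixed (drop_at i x) \<Longrightarrow> mixed x"
    using mixed_mono[OF set_drop_at_subset] .
  moreover have "Poly_Mapping.keys (MC_face I i x) \<subseteq> k_paths X (k - 1)"
    using keys_MC_face[OF x(1)] assms by simp
  ultimately show ?thesis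
    using assms(1) by (auto simp: MC_face_def lower_def)
qed

lemma keys_face_outside:
  assumes "x \<in> k_paths X k" "0 < i" "i < k" "x ! i \<notin> W"
  shows "Poly_Mapping.keys (MC_face I i x) \<subseteq> lower (length (outside x)) (k - 1)"
proof -
  have "length x = Suc k" using assms by (simp add: k_paths_def)
  then have "length (outside (drop_at i x)) < length (outside x)"
    using length_filter_drop_at_less[of i x "\<lambda>x. x \<notin> W"] assms by simp
  moreover have "Poly_Mapping.keys (MC_face I i x) \<subseteq> k_paths X (k - 1)"
    using keys_MC_face[OF assms(1)] assms by simp
  ultimately show ?thesis by (auto simp: MC_face_def lower_def)
qed

lemma keys_boundary_lower:
  assumes "Poly_Mapping.keys c \<subseteq> lower n k"
  shows "Poly_Mapping.keys (MC_boundary I k c) \<subseteq> lower n (k - 1)"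
  unfolding MC_boundary_def
  by (rule keys_frag_extend_subset[OF assms]) (intro keys_sum_subset keys_cmul_subset keys_face_lower, auto)

text \<open>
  For a face that removes an entry in \<open>W\<close>, inserting the gate and taking the face commute. The equation
  includes the degenerate cases: if the face of the enlarged path has equal neighbours, both sides are \<open>0\<close>;
  if it has none, neither has the face of \<open>x\<close>.
\<close>

lemma homotopy_face:
  assumes "x \<in> k_paths X k" "mixed x" "0 < i" "i < k" "x ! i \<in> W"
  shows "homotopy (MC_face I i x) =
    frag_cmul ((-1) ^ (if i < slot x then slot x - 1 else slot x))
      (MC_face I (if i < slot x then i else Suc i) (insert_gate x))"
proof -
  let ?j = "if i < slot x then i else Suc i"
  let ?u = "drop_at i x"
  have x: "set x \<subseteq> X" "length x = Suc k" using assms by (auto simp: k_paths_def)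
  have u: "set ?u \<subseteq> X" using order_trans[OF set_drop_at_subset x(1)] .
  have i: "i < length x" using x assms by simp
  have o: "outside ?u = outside x" using outside_drop_at[OF i assms(5)] .
  have mixed: "mixed ?u" using mixed_cong[OF u x(1) o] assms(2) by simp
  have ins: "insert_gate ?u = drop_at ?j (insert_gate x)"
    using insert_gate_drop_at[OF assms(2) x(1) i assms(5)] by simp
  have bet: "insert_gate x ! ?j \<in> I (insert_gate x ! (?j - 1)) (insert_gate x ! (?j + 1)) \<longleftrightarrow>
         x ! i \<in> I (x ! (i - 1)) (x ! (i + 1))"
    using between_insert_gate[OF assms(2) x(1) assms(3) _ assms(5)] assms(4) x(2) by simp
  have face': "MC_face I ?j (insert_gate x) =
      (if x ! i \<in> I (x ! (i - 1)) (x ! (i + 1)) \<and> distinct_adj (insert_gate ?u)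
       then frag_of (insert_gate ?u) else 0)"
    unfolding MC_face_def bet ins[symmetric] ..
  have da: "distinct_adj (insert_gate ?u) \<Longrightarrow> distinct_adj ?u"
    using distinct_adj_insert_gateD[OF mixed u] .
  have slot: "slot ?u = (if i < slot x then slot x - 1 else slot x)"
    using slot_drop_at[OF assms(2) x(1) i assms(5)] .
  show ?thesis
    unfolding face' slot[symmetric] using mixed da by (auto simp: MC_face_def insertion_def)
qed

lemma homotopy_identity_unmixed:
  assumes "x \<in> k_paths X k" "\<not> mixed x"
  shows "Poly_Mapping.keys (homotopy (MC_boundary I k (frag_of x)) + MC_boundary I (Suc k) (homotopy (frag_of x)) - frag_of x)
     \<subseteq> lower n k"
proof -
  have x': "x \<in> lower m k" for m using assms by (simp add: lower_def)
  have "homotopy (MC_boundary I k (frag_of x)) = 0"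
    using homotopy_unmixed keys_boundary_lower[of "frag_of x" 0 k] x' by simp
  moreover have "homotopy (frag_of x) = 0" using assms by (simp add: insertion_def)
  ultimately show ?thesis using x' by simp
qed

text \<open>
  In the boundary of the enlarged path, removing the gate gives back \<open>x\<close>, and the other faces that remove
  an entry in \<open>W\<close> cancel against the insertions into the corresponding faces of \<open>x\<close>. The faces that remove
  an entry outside \<open>W\<close> do not cancel, but they have fewer such entries.
\<close>

lemma homotopy_identity_up:
  assumes x: "x \<in> k_paths X k" and mixed: "mixed x" and da: "distinct_adj (insert_gate x)"
  shows "Poly_Mapping.keys (homotopy (MC_boundary I k (frag_of x)) + MC_boundary I (Suc k) (homotopy (frag_of x)) - frag_of x)
     \<subseteq> lower (length (outside x)) k"
proof -
  let ?v = "insert_gate x" and ?t = "slot x"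
  let ?j = "\<lambda>i. if i < ?t then i else Suc i"
  let ?G = "\<lambda>l. frag_cmul ((-1) ^ (?t + l)) (MC_face I l ?v)"
  have X': "set x \<subseteq> X" and len: "length x = Suc k" and da': "distinct_adj x" using x by (auto simp: k_paths_def)
  have t: "0 < ?t" "?t \<le> k" using slot_bounds[OF mixed X'] len by auto
  have nth: "?v ! l = (if l < ?t then x ! l else if l = ?t then gate x else x ! (l - 1))"
    if "l \<le> length x" for l
    unfolding insert_gate_def using nth_insert_at[of ?t x l "gate x"] that t len by simp
  have "gate x \<in> I (x ! (?t - 1)) (x ! ?t)"
    using mixed X' by (cases rule: slot_cases) (auto intro: gate_between gate_between_rev)
  then have "MC_face I ?t ?v = frag_of x"
    using t len da' by (simp add: MC_face_def nth) (simp add: insert_gate_def)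
  then have Gt: "?G ?t = frag_of x" by (simp flip: mult_2)
  have "MC_boundary I (Suc k) (homotopy (frag_of x)) = sum ?G {1..<Suc k}"
    using mixed da
    by (simp add: insertion_def MC_boundary_def frag_extend_cmul frag_cmul_sum power_add del: sum.op_ivl_Suc)
  also have "\<dots> = frag_of x + (\<Sum>i\<in>{1..<k}. ?G (?j i))"
    by (simp only: sum_skip[OF t] Gt)
  finally have up: "MC_boundary I (Suc k) (homotopy (frag_of x)) = frag_of x + (\<Sum>i\<in>{1..<k}. ?G (?j i))" .
  have down: "homotopy (MC_boundary I k (frag_of x)) =
      (\<Sum>i\<in>{1..<k}. frag_cmul ((-1) ^ i) (homotopy (MC_face I i x)))"
    by (simp add: MC_boundary_frag_of frag_extend_sum frag_extend_cmul)
  have eq: "homotopy (MC_boundary I k (frag_of x)) + MC_boundary I (Suc k) (homotopy (frag_of x)) - frag_of x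
    = (\<Sum>i\<in>{1..<k}. frag_cmul ((-1) ^ i) (homotopy (MC_face I i x)) + ?G (?j i))"
    unfolding up down by (simp add: sum.distrib)
  have v_path: "?v \<in> k_paths X (Suc k)" using insert_gate_k_path[OF x mixed da] .
  show ?thesis
    unfolding eq
  proof (rule keys_sum_subset)
    fix i assume "i \<in> {1..<k}"
    then have i: "0 < i" "i < k" by auto
    show "Poly_Mapping.keys (frag_cmul ((-1) ^ i) (homotopy (MC_face I i x)) + ?G (?j i)) \<subseteq> lower (length (outside x)) k"
    proof (cases "x ! i \<in> W")
      case True
      \<comment> \<open>Passing from \<open>x\<close> to the face moves the slot by one if \<open>i < t\<close>; otherwise, the insertion moves the index of the face by one.\<close>
      have sgn: "(-1) ^ i * (-1) ^ (if i < ?t then ?t - 1 else ?t) + (-1) ^ (?t + ?j i) = (0::int)"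
        using t(1) by (cases ?t) (auto simp: power_add)
      have "frag_cmul ((-1) ^ i) (homotopy (MC_face I i x)) + ?G (?j i) =
          frag_cmul ((-1) ^ i * (-1) ^ (if i < ?t then ?t - 1 else ?t) + (-1) ^ (?t + ?j i)) (MC_face I (?j i) ?v)"
        by (simp only: homotopy_face[OF x mixed i True] frag_cmul_cmul frag_cmul_distrib)
      then show ?thesis unfolding sgn by simp
    next
      case False
      have "Poly_Mapping.keys (homotopy (MC_face I i x)) \<subseteq> lower (length (outside x)) (Suc (k - 1))"
        using keys_homotopy[OF keys_face_outside[OF x i False]] .
      moreover have "?v ! ?j i \<notin> W" using False nth[of "?j i"] i len by auto
      then have "Poly_Mapping.keys (MC_face I (?j i) ?v) \<subseteq> lower (length (outside x)) k"
        using keys_face_outside[OF v_path, of "?j i"] i outside_insert_gate[OF mixed X'] by simp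
      ultimately show ?thesis
        using i by (intro keys_add_subset keys_cmul_subset) simp_all
    qed
  qed
qed

text \<open>
  A mixed path \<open>x\<close> in which inserting the gate creates equal neighbours is, up to sign, the image under the
  homotopy \<open>h\<close> of a path \<open>u\<close> to which the previous identity applies. Applying \<open>h\<close> to the
  identity for \<open>u\<close> gives the one for \<open>x\<close>, because \<open>h\<close> has square zero: \<open>h\<close> kills \<open>x\<close> and
  \<open>h (\<partial> u)\<close>, so that what remains of \<open>h \<partial> h u - h u\<close> is \<open>h \<partial> x - x\<close>.
\<close>

lemma homotopy_identity:
  assumes x: "x \<in> k_paths X k"
  shows "Poly_Mapping.keys (homotopy (MC_boundary I k (frag_of x)) + MC_boundary I (Suc k) (homotopy (frag_of x)) - frag_of x)
     \<subseteq> lower (length (outside x)) k"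
proof (cases "mixed x")
  case False
  then show ?thesis using homotopy_identity_unmixed[OF x] by blast
next
  case mixed: True
  show ?thesis
  proof (cases "distinct_adj (insert_gate x)")
    case True
    then show ?thesis using homotopy_identity_up x mixed by blast
  next
    case False
    have X': "set x \<subseteq> X" and da: "distinct_adj x" and len: "length x = Suc k"
      using x by (auto simp: k_paths_def)
    obtain u where u: "mixed u" "set u \<subseteq> X" "insert_gate u = x"
      using insert_gate_or_inserted[OF mixed X' da False] by blast
    have "length u = k" using len unfolding u(3)[symmetric] by simp
    moreover have "u \<noteq> []" using u(1) by (auto simp: mixed_def)
    ultimately obtain k' where k: "k = Suc k'" "length u = Suc k'" by (cases k) auto
    have da_u: "distinct_adj (insert_gate u)" using u(3) da by simp
    have up: "u \<in> k_paths X k'"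
      using k u distinct_adj_insert_gateD[OF u(1,2) da_u] by (simp add: k_paths_def)
    have o: "outside u = outside x" using outside_insert_gate[OF u(1,2)] u(3) by simp
    have hu: "homotopy (frag_of u) = frag_cmul ((-1) ^ slot u) (frag_of x)"
      using u da_u by (simp add: insertion_def)
    then have xu: "frag_of x = frag_cmul ((-1) ^ slot u) (homotopy (frag_of u))"
      by (simp flip: power_add mult_2)
    have bu: "Poly_Mapping.keys (MC_boundary I k' (frag_of u)) \<subseteq> k_paths X (k' - 1)"
      using keys_MC_boundary[of "frag_of u"] up by simp
    have "homotopy (homotopy (MC_boundary I k' (frag_of u)) + MC_boundary I k (homotopy (frag_of u)) - frag_of u)
       = homotopy (MC_boundary I k (homotopy (frag_of u))) - homotopy (frag_of u)"
      by (simp add: frag_extend_add frag_extend_diff homotopy_homotopy[OF bu])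
    then have *: "Poly_Mapping.keys (homotopy (MC_boundary I k (homotopy (frag_of u))) - homotopy (frag_of u))
        \<subseteq> lower (length (outside x)) k"
      using keys_homotopy[OF homotopy_identity_up[OF up u(1) da_u]] by (simp add: k o)
    have hx: "homotopy (frag_of x) = 0" using False by (simp add: insertion_def)
    have "homotopy (MC_boundary I k (frag_of x)) + MC_boundary I (Suc k) (homotopy (frag_of x)) - frag_of x
       = homotopy (MC_boundary I k (frag_of x)) - frag_of x"
      unfolding hx by simp
    also have "\<dots> = frag_cmul ((-1) ^ slot u) (homotopy (MC_boundary I k (homotopy (frag_of u))) - homotopy (frag_of u))"
      by (simp only: xu MC_boundary_def frag_extend_cmul frag_cmul_diff)
    finally show ?thesis using keys_cmul_subset[OF *] by simp
  qed
qed

lemma keys_homotopy_reduces: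
  assumes "Poly_Mapping.keys c \<subseteq> lower (Suc n) k"
  shows "Poly_Mapping.keys (homotopy (MC_boundary I k c) + MC_boundary I (Suc k) (homotopy c) - c) \<subseteq> lower n k"
  using assms
proof (induction c rule: frag_induction)
  case zero
  then show ?case by simp
next
  case (one x)
  then have x: "x \<in> k_paths X k" by (simp add: lower_def)
  show ?case
  proof (cases "mixed x")
    case True
    then have "length (outside x) \<le> n" using one by (simp add: lower_def)
    then show ?thesis using order_trans[OF homotopy_identity[OF x] lower_mono] by blast
  next
    case False
    then show ?thesis using homotopy_identity_unmixed[OF x] by blast
  qed
next
  case (diff a b)
  have "homotopy (MC_boundary I k (a - b)) + MC_boundary I (Suc k) (homotopy (a - b)) - (a - b) =
    (homotopy (MC_boundary I k a) + MC_boundary I (Suc k) (homotopy a) - a) -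
    (homotopy (MC_boundary I k b) + MC_boundary I (Suc k) (homotopy b) - b)"
    by (simp add: MC_boundary_diff frag_extend_diff)
  then show ?case using keys_diff_subset[OF diff] by (simp only:)
qed

end

section \<open>Excision and the retraction\<close>

locale gated_complex = gated_space +
  assumes boundary_boundary: "c \<in> carrier (MC X (Suc (Suc n))) \<Longrightarrow>
      MC_boundary I (Suc n) (MC_boundary I (Suc (Suc n)) c) = 0"
    and gate_id: "w \<in> W \<Longrightarrow> \<pi> w = w"
    and good: "tuples W \<subseteq> max_good_set Z (sub_intervals I Z) (sub_intervals I W) \<pi>"
begin

lemma subsets: "Y \<subseteq> X" "Z \<subseteq> X" "W \<subseteq> X" "W \<subseteq> Y" "W \<subseteq> Z"
  using X W by auto

text \<open>
  Subtracting from \<open>c\<close> the boundary of its image under the homotopy lowers the filtration degree: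
  the other term of the homotopy identity is zero, as the homotopy kills the boundary of \<open>c\<close>.
  That \<open>\<partial>\<partial> = 0\<close> is needed to see that the new chain has the same boundary.
\<close>

lemma excision:
  assumes c: "Poly_Mapping.keys c \<subseteq> lower n k"
    and bc: "Poly_Mapping.keys (MC_boundary I k c) \<subseteq> lower 0 (k - 1)"
  shows "\<exists>e. Poly_Mapping.keys e \<subseteq> k_paths X (Suc k) \<and> Poly_Mapping.keys (c - MC_boundary I (Suc k) e) \<subseteq> lower 0 k"
  using c bc
proof (induction n arbitrary: c)
  case 0
  then show ?case by (intro exI[of _ 0]) simp
next
  case (Suc n)
  let ?c = "c - MC_boundary I (Suc k) (homotopy c)"
  have hc: "Poly_Mapping.keys (homotopy c) \<subseteq> k_paths X (Suc k)"
    using Suc.prems(1) by (intro keys_homotopy_k_paths) (auto simp: lower_def)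
  have "MC_boundary I k (MC_boundary I (Suc k) (homotopy c)) = 0"
    using boundary_boundary[of "homotopy c" "k - 1"] hc by (cases k) (auto simp: carrier_MC)
  then have "MC_boundary I k ?c = MC_boundary I k c" by (simp add: MC_boundary_diff)
  moreover have "homotopy (MC_boundary I k c) = 0" using homotopy_unmixed Suc.prems(2) by blast
  then have "Poly_Mapping.keys (- ?c) \<subseteq> lower n k"
    using keys_homotopy_reduces[OF Suc.prems(1)] by simp
  then have "Poly_Mapping.keys ?c \<subseteq> lower n k" by (simp only: keys_minus)
  ultimately obtain e where e: "Poly_Mapping.keys e \<subseteq> k_paths X (Suc k)"
      "Poly_Mapping.keys (?c - MC_boundary I (Suc k) e) \<subseteq> lower 0 k"
    using Suc.IH[of ?c] Suc.prems(2) by auto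
  then show ?case
    using keys_add_subset[OF hc e(1)]
    by (intro exI[of _ "homotopy c + e"]) (simp add: MC_boundary_add diff_diff_eq)
qed

lemma lower_0: "lower 0 k = k_paths Y k \<union> k_paths Z k"
proof -
  have "Y \<subseteq> X" "Z \<subseteq> X" using X by auto
  then show ?thesis by (auto simp: lower_def mixed_def k_paths_def)
qed

lemma k_paths_lower: "k_paths X k \<subseteq> lower (Suc (Suc k)) k"
proof
  fix x assume "x \<in> k_paths X k"
  then show "x \<in> lower (Suc (Suc k)) k"
    using length_filter_le[of "\<lambda>x. x \<notin> W" x] by (auto simp: lower_def k_paths_def)
qed

lemma chain_split:
  assumes c: "Poly_Mapping.keys c \<subseteq> k_paths X k"
    and bc: "Poly_Mapping.keys (MC_boundary I k c) \<subseteq> k_paths Y (k - 1) \<union> k_paths Z (k - 1)"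
  obtains e a b where "Poly_Mapping.keys e \<subseteq> k_paths X (Suc k)" "Poly_Mapping.keys a \<subseteq> k_paths Y k"
    "Poly_Mapping.keys b \<subseteq> k_paths Z k" "c = MC_boundary I (Suc k) e + a + b"
proof -
  obtain e where e: "Poly_Mapping.keys e \<subseteq> k_paths X (Suc k)"
      "Poly_Mapping.keys (c - MC_boundary I (Suc k) e) \<subseteq> k_paths Y k \<union> k_paths Z k"
    using excision[OF order_trans[OF c k_paths_lower]] bc by (auto simp: lower_0)
  obtain a b where ab: "Poly_Mapping.keys a \<subseteq> k_paths Y k" "Poly_Mapping.keys b \<subseteq> k_paths Z k"
      "a + b = c - MC_boundary I (Suc k) e"
    using frag_split[OF e(2)] by blast
  then show thesis using that[OF e(1) ab(1,2)] by (simp add: algebra_simps)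
qed

lemma k_paths_W: "k_paths W k = k_paths Y k \<inter> k_paths Z k"
  using W by (auto simp: k_paths_def)

definition retract :: "('a list \<Rightarrow>\<^sub>0 int) \<Rightarrow> ('a list \<Rightarrow>\<^sub>0 int)" where
  "retract = good_map (max_good_set Z (sub_intervals I Z) (sub_intervals I W) \<pi>) \<pi>"

lemma keys_retract:
  "Poly_Mapping.keys c \<subseteq> k_paths Z l \<Longrightarrow> Poly_Mapping.keys (retract c) \<subseteq> k_paths W l"
  unfolding retract_def by (rule keys_good_map) (auto simp: gate_mem)

lemma retract_id: "Poly_Mapping.keys c \<subseteq> k_paths W l \<Longrightarrow> retract c = c"
  unfolding retract_def by (rule good_map_id[OF _ good gate_id])

lemma retract_boundary:
  assumes c: "Poly_Mapping.keys c \<subseteq> k_paths Z l"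
  shows "MC_boundary I l (retract c) = retract (MC_boundary I l c)"
proof -
  have ends: "x \<in> sub_intervals I W x z \<and> z \<in> sub_intervals I W x z" if "x \<in> W" "z \<in> W" for x z
    using that space subsetD[OF subsets(3)] unfolding betweenness_space_def sub_intervals_def by simp
  have "MC_boundary (sub_intervals I W) l (retract c) = retract (MC_boundary (sub_intervals I Z) l c)"
    unfolding retract_def
    by (rule good_map_boundary[OF good_set_max_good_set _ ends c]) (auto simp: gate_mem)
  then show ?thesis by (simp add: MC_boundary_sub_intervals c keys_retract[OF c])
qed

text \<open>
  A bounding chain on \<open>Z\<close> retracts to a bounding chain on \<open>W\<close>.
\<close>

lemma inclusion_injective:
  assumes "c \<in> MC_cycles W I k" "c \<in> MC_boundaries Z I k"
  shows "c \<in> MC_boundaries W I k"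
proof -
  obtain b where b: "Poly_Mapping.keys b \<subseteq> k_paths Z (Suc k)" "c = MC_boundary I (Suc k) b"
    using assms(2) by (auto simp: MC_boundaries_def carrier_MC)
  have "c = retract c" using retract_id[of c k] assms(1) by (simp add: MC_cycles_def carrier_MC)
  then have "c = MC_boundary I (Suc k) (retract b)" using b retract_boundary by simp
  then show ?thesis using keys_retract[OF b(1)] by (auto simp: MC_boundaries_def carrier_MC)
qed

text \<open>
  Excision replaces a chain on \<open>X\<close> that bounds \<open>a + b\<close> by a sum of a chain \<open>u\<close> on \<open>Y\<close> and a chain \<open>v\<close> on \<open>Z\<close>
  with the same boundary. Then \<open>a - \<partial> u = \<partial> v - b\<close> is a chain on both \<open>Y\<close> and \<open>Z\<close>, hence on \<open>W\<close>.
\<close>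

lemma exact_in_middle:
  assumes a: "a \<in> MC_cycles Y I k" and b: "b \<in> MC_cycles Z I k" and ab: "a + b \<in> MC_boundaries X I k"
  shows "\<exists>w \<in> MC_cycles W I k. a - w \<in> MC_boundaries Y I k \<and> b + w \<in> MC_boundaries Z I k"
proof -
  obtain c where c: "Poly_Mapping.keys c \<subseteq> k_paths X (Suc k)" "a + b = MC_boundary I (Suc k) c"
    using ab by (auto simp: MC_boundaries_def carrier_MC)
  have "Poly_Mapping.keys (a + b) \<subseteq> k_paths Y k \<union> k_paths Z k"
    using a b keys_add_subset[of a "k_paths Y k \<union> k_paths Z k" b] by (auto simp: MC_cycles_def carrier_MC)
  then have "Poly_Mapping.keys (MC_boundary I (Suc k) c) \<subseteq> k_paths Y (Suc k - 1) \<union> k_paths Z (Suc k - 1)"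
    using c(2) by simp
  from chain_split[OF c(1) this] obtain e u v where
    e: "Poly_Mapping.keys e \<subseteq> k_paths X (Suc (Suc k))" and u: "Poly_Mapping.keys u \<subseteq> k_paths Y (Suc k)"
    and v: "Poly_Mapping.keys v \<subseteq> k_paths Z (Suc k)" and ceq: "c = MC_boundary I (Suc (Suc k)) e + u + v"
    by blast
  have "MC_boundary I (Suc k) (MC_boundary I (Suc (Suc k)) e) = 0" using boundary_boundary e by (simp add: carrier_MC)
  then have eq: "a + b = MC_boundary I (Suc k) u + MC_boundary I (Suc k) v"
    using c(2) by (simp add: ceq MC_boundary_add)
  let ?w = "a - MC_boundary I (Suc k) u"
  have w: "?w = MC_boundary I (Suc k) v - b" using eq by (simp add: algebra_simps)
  have "MC_boundaries Y I k \<subseteq> MC_cycles Y I k"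
    using MC_boundaries_subset_cycles[OF boundary_boundary subsets(1)] .
  moreover have bu: "MC_boundary I (Suc k) u \<in> MC_boundaries Y I k"
    using u by (auto simp: MC_boundaries_def carrier_MC)
  ultimately have du: "MC_boundary I k (MC_boundary I (Suc k) u) = 0"
    by (auto simp: MC_cycles_def)
  have "Poly_Mapping.keys ?w \<subseteq> k_paths Y k"
    using keys_diff_subset[of a "k_paths Y k"] a keys_MC_boundary[OF u, of I] by (simp add: MC_cycles_def carrier_MC)
  moreover have "Poly_Mapping.keys ?w \<subseteq> k_paths Z k"
    unfolding w using keys_diff_subset[of _ "k_paths Z k" b] b keys_MC_boundary[OF v, of I]
    by (simp add: MC_cycles_def carrier_MC)
  moreover have "MC_boundary I k ?w = 0" using a du by (simp add: MC_boundary_diff MC_cycles_def)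
  ultimately have "?w \<in> MC_cycles W I k" by (simp add: MC_cycles_def carrier_MC k_paths_W)
  moreover have "b + ?w \<in> MC_boundaries Z I k" unfolding w using v by (auto simp: MC_boundaries_def carrier_MC)
  ultimately show ?thesis using bu by (intro bexI[of _ ?w]) auto
qed

text \<open>
  For the chains \<open>a\<close> and \<open>b\<close> given by excision, \<open>\<partial> a = - \<partial> b\<close> is a chain on \<open>W\<close>, so it is fixed by the
  retraction. Hence the retract of \<open>b\<close> has the same boundary as \<open>b\<close>, and shifting it from \<open>b\<close> to \<open>a\<close>
  leaves two cycles.
\<close>

lemma cycle_decomposition:
  assumes c: "c \<in> MC_cycles X I k"
  shows "\<exists>a \<in> MC_cycles Y I k. \<exists>b \<in> MC_cycles Z I k. c - (a + b) \<in> MC_boundaries X I k"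
proof -
  have ck: "Poly_Mapping.keys c \<subseteq> k_paths X k" and dc: "MC_boundary I k c = 0"
    using c by (auto simp: MC_cycles_def carrier_MC)
  have "Poly_Mapping.keys (MC_boundary I k c) \<subseteq> k_paths Y (k - 1) \<union> k_paths Z (k - 1)"
    unfolding dc by simp
  from chain_split[OF ck this] obtain e a b where
    e: "Poly_Mapping.keys e \<subseteq> k_paths X (Suc k)" and a: "Poly_Mapping.keys a \<subseteq> k_paths Y k"
    and b: "Poly_Mapping.keys b \<subseteq> k_paths Z k" and ceq: "c = MC_boundary I (Suc k) e + a + b"
    by blast
  have be: "MC_boundary I (Suc k) e \<in> MC_boundaries X I k" using e by (auto simp: MC_boundaries_def carrier_MC)
  then have "MC_boundary I k (MC_boundary I (Suc k) e) = 0"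
    using MC_boundaries_subset_cycles[OF boundary_boundary order_refl] by (auto simp: MC_cycles_def)
  then have dab: "MC_boundary I k a = - MC_boundary I k b"
    using dc by (simp add: ceq MC_boundary_add eq_neg_iff_add_eq_0)
  have "Poly_Mapping.keys (MC_boundary I k a) \<subseteq> k_paths W (k - 1)"
    using keys_MC_boundary[OF a, of I] keys_MC_boundary[OF b, of I]
    unfolding k_paths_W by (simp add: dab)
  then have "retract (MC_boundary I k b) = MC_boundary I k b"
    using retract_id[of "MC_boundary I k b" "k - 1"] by (simp add: dab)
  then have dr: "MC_boundary I k (retract b) = MC_boundary I k b" using retract_boundary[OF b] by simp
  have rb: "Poly_Mapping.keys (retract b) \<subseteq> k_paths Y k" "Poly_Mapping.keys (retract b) \<subseteq> k_paths Z k"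
    using keys_retract[OF b] by (auto simp: k_paths_W)
  have "a + retract b \<in> MC_cycles Y I k" "b - retract b \<in> MC_cycles Z I k"
    using keys_add_subset[OF a rb(1)] keys_diff_subset[OF b rb(2)]
    by (simp_all add: MC_cycles_def carrier_MC MC_boundary_add MC_boundary_diff dr dab)
  moreover have "c - ((a + retract b) + (b - retract b)) \<in> MC_boundaries X I k" using be by (simp add: ceq)
  ultimately show ?thesis by blast
qed

end

section \<open>The short exact sequence\<close>

theorem theorem6p22:
  fixes X Y Z W :: "'a set" and I :: "'a \<Rightarrow> 'a \<Rightarrow> 'a set" and \<pi> :: "'a \<Rightarrow> 'a" and k :: nat
  assumes space: "betweenness_space X I"
    and gated: "gated_decomposition X I Y Z \<pi>"
    and W: "W = Y \<inter> Z"
    and complex: "\<And>n c. c \<in> carrier (MC X (Suc (Suc n))) \<Longrightarrow>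
                    MC_boundary I (Suc n) (MC_boundary I (Suc (Suc n)) c) = 0"
    and gate_reversed: "\<And>z y. z \<in> Z \<Longrightarrow> y \<in> Y \<Longrightarrow> \<pi> z \<in> I y z"
  shows "short_exact
           (MH W (sub_intervals I W) k)
           (MH Y (sub_intervals I Y) k \<times>\<times> MH Z (sub_intervals I Z) k)
           (MH X I k)
           (\<lambda>u. (MH_incl Y (sub_intervals I Y) k u,
                  inv\<^bsub>MH Z (sub_intervals I Z) k\<^esub> (MH_incl Z (sub_intervals I Z) k u)))
           (\<lambda>(u, v). MH_incl X I k u \<otimes>\<^bsub>MH X I k\<^esub> MH_incl X I k v)"
proof -
  note defs = gated[unfolded gated_decomposition_def, folded W]
  interpret gated_complex X Y Z W I \<pi>
  proof
    show "betweenness_space X I" "X = Y \<union> Z" "W = Y \<inter> Z" using space defs W by blast+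
    show "\<pi> z \<in> W" if "z \<in> Z" for z using defs that by blast
    show "\<pi> z \<in> I z y" if "z \<in> Z" "y \<in> Y" for z y using defs that by blast
    show "\<pi> z \<in> I y z" if "z \<in> Z" "y \<in> Y" for z y using gate_reversed that .
    show "MC_boundary I (Suc n) (MC_boundary I (Suc (Suc n)) c) = 0" if "c \<in> carrier (MC X (Suc (Suc n)))" for n c
      using complex that .
    show "\<pi> w = w" if "w \<in> W" for w using defs that by blast
    show "tuples W \<subseteq> max_good_set Z (sub_intervals I Z) (sub_intervals I W) \<pi>" using defs by blast
  qed
  note sub = subsets
  let ?MW = "MH W (sub_intervals I W) k" and ?MY = "MH Y (sub_intervals I Y) k"
    and ?MZ = "MH Z (sub_intervals I Z) k" and ?MX = "MH X I k"
  let ?f = "\<lambda>u. (MH_incl Y (sub_intervals I Y) k u, inv\<^bsub>?MZ\<^esub> (MH_incl Z (sub_intervals I Z) k u))"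
  let ?g = "\<lambda>(u, v). MH_incl X I k u \<otimes>\<^bsub>?MX\<^esub> MH_incl X I k v"
  have comm: "comm_group (MH A (sub_intervals I A) k)" if "A \<subseteq> X" for A
    using comm_group_MH[of A "sub_intervals I A" k] MC_boundaries_subset_cycles[OF complex that]
    by (simp add: MC_boundaries_sub_intervals MC_cycles_sub_intervals)
  have commX: "comm_group ?MX"
    using comm_group_MH MC_boundaries_subset_cycles[OF complex order_refl] .
  note cg = comm[OF sub(3)] comm[OF sub(1)] comm[OF sub(2)] commX
  have carrier: "carrier (MH A (sub_intervals I A) k) = homology_class A I k ` MC_cycles A I k" for A
    by (simp add: carrier_MH homology_class_sub_intervals[abs_def] MC_cycles_sub_intervals)
  have mult: "homology_class A I k c \<otimes>\<^bsub>MH A (sub_intervals I A) k\<^esub> homology_class A I k d = homology_class A I k (c + d)"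
    for A c d
    using mult_MH_homology_class[of A "sub_intervals I A"] by (simp add: homology_class_sub_intervals)
  have incl: "MH_incl B (sub_intervals I B) k (homology_class A I k c) = homology_class B I k c" if "A \<subseteq> B" for A B c
    using MH_incl_homology_class[OF that, of "sub_intervals I B" k c]
    by (simp add: sub_intervals_sub_intervals[OF that] homology_class_sub_intervals)
  have inclX: "MH_incl X I k (homology_class A I k c) = homology_class X I k c" if "A \<subseteq> X" for A c
    using MH_incl_homology_class[OF that, of I k c] by (simp add: homology_class_sub_intervals)
  have cycles: "c \<in> MC_cycles Y I k" "c \<in> MC_cycles Z I k" "- c \<in> MC_cycles Z I k" if "c \<in> MC_cycles W I k" for c
    using that by (auto simp: MC_cycles_def carrier_MC k_paths_W MC_boundary_minus)
  have f: "?f (homology_class W I k c) = (homology_class Y I k c, homology_class Z I k (- c))"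
    if "c \<in> MC_cycles W I k" for c
    using inv_MH_homology_class[OF cg(3), of c] cycles[OF that]
    by (simp add: incl sub MC_cycles_sub_intervals homology_class_sub_intervals)
  have g: "?g (homology_class Y I k a, homology_class Z I k b) = homology_class X I k (a + b)" for a b
    by (simp add: inclX sub mult_MH_homology_class)
  have cyc_add: "a + b \<in> MC_cycles A I k" if "a \<in> MC_cycles A I k" "b \<in> MC_cycles A I k" for A a b
    using that keys_add_subset by (auto simp: MC_cycles_def carrier_MC MC_boundary_add)
  have cyc_mono: "MC_cycles A I k \<subseteq> MC_cycles X I k" if "A \<subseteq> X" for A
    using k_paths_mono[OF that] by (auto simp: MC_cycles_def carrier_MC)

  have "?f \<in> hom ?MW (?MY \<times>\<times> ?MZ)"
  proof (rule homI)
    fix u assume "u \<in> carrier ?MW"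
    then obtain c where c: "c \<in> MC_cycles W I k" "u = homology_class W I k c" by (auto simp: carrier)
    show "?f u \<in> carrier (?MY \<times>\<times> ?MZ)"
      unfolding c(2) f[OF c(1)] using cycles[OF c(1)] by (simp add: carrier)
  next
    fix u v assume "u \<in> carrier ?MW" "v \<in> carrier ?MW"
    then obtain c d where c: "c \<in> MC_cycles W I k" "u = homology_class W I k c"
      and d: "d \<in> MC_cycles W I k" "v = homology_class W I k d" by (auto simp: carrier)
    show "?f (u \<otimes>\<^bsub>?MW\<^esub> v) = ?f u \<otimes>\<^bsub>?MY \<times>\<times> ?MZ\<^esub> ?f v"
      unfolding c(2) d(2) mult f[OF c(1)] f[OF d(1)] f[OF cyc_add[OF c(1) d(1)]]
      by (simp add: mult)
  qed
  moreover have "inj_on ?f (carrier ?MW)"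
  proof (rule inj_onI)
    fix u v assume "u \<in> carrier ?MW" "v \<in> carrier ?MW" and eq: "?f u = ?f v"
    then obtain c d where c: "c \<in> MC_cycles W I k" "u = homology_class W I k c"
      and d: "d \<in> MC_cycles W I k" "v = homology_class W I k d" by (auto simp: carrier)
    have "homology_class Z I k (- c) = homology_class Z I k (- d)"
      using eq unfolding c(2) d(2) f[OF c(1)] f[OF d(1)] by simp
    then have "d - c \<in> MC_boundaries Z I k" by (simp add: homology_class_eq_iff)
    then have "c - d \<in> MC_boundaries Z I k" using MC_boundaries_closed(3) by force
    moreover have "c - d \<in> MC_cycles W I k"
      using c(1) d(1) keys_diff_subset by (auto simp: MC_cycles_def carrier_MC MC_boundary_diff)
    ultimately show "u = v" using inclusion_injective c d by (simp add: homology_class_eq_iff)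
  qed
  ultimately have mon: "?f \<in> mon ?MW (?MY \<times>\<times> ?MZ)" by (simp add: mon_def)

  have "?g \<in> hom (?MY \<times>\<times> ?MZ) ?MX"
  proof (rule homI)
    fix p assume "p \<in> carrier (?MY \<times>\<times> ?MZ)"
    then obtain a b where p: "a \<in> MC_cycles Y I k" "b \<in> MC_cycles Z I k"
        "p = (homology_class Y I k a, homology_class Z I k b)" by (auto simp: carrier)
    have "a + b \<in> MC_cycles X I k" using p cyc_mono[OF sub(1)] cyc_mono[OF sub(2)] cyc_add by blast
    then show "?g p \<in> carrier ?MX" unfolding p(3) g by (simp add: carrier_MH)
  next
    fix p q assume "p \<in> carrier (?MY \<times>\<times> ?MZ)" "q \<in> carrier (?MY \<times>\<times> ?MZ)"
    then obtain a b c d where p: "p = (homology_class Y I k a, homology_class Z I k b)"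
        and q: "q = (homology_class Y I k c, homology_class Z I k d)" by (auto simp: carrier)
    have pq: "p \<otimes>\<^bsub>?MY \<times>\<times> ?MZ\<^esub> q = (homology_class Y I k (a + c), homology_class Z I k (b + d))"
      by (simp add: p q mult)
    show "?g (p \<otimes>\<^bsub>?MY \<times>\<times> ?MZ\<^esub> q) = ?g p \<otimes>\<^bsub>?MX\<^esub> ?g q"
      unfolding pq unfolding p q g mult_MH_homology_class by (simp add: algebra_simps)
  qed
  moreover have "?g ` carrier (?MY \<times>\<times> ?MZ) = carrier ?MX"
  proof
    show "?g ` carrier (?MY \<times>\<times> ?MZ) \<subseteq> carrier ?MX"
      using hom_carrier[OF calculation] .
    show "carrier ?MX \<subseteq> ?g ` carrier (?MY \<times>\<times> ?MZ)"
    proof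
      fix v assume "v \<in> carrier ?MX"
      then obtain c where c: "c \<in> MC_cycles X I k" "v = homology_class X I k c" by (auto simp: carrier_MH)
      obtain a b where ab: "a \<in> MC_cycles Y I k" "b \<in> MC_cycles Z I k" "c - (a + b) \<in> MC_boundaries X I k"
        using cycle_decomposition[OF c(1)] by blast
      have "v = ?g (homology_class Y I k a, homology_class Z I k b)"
        unfolding g c(2) using ab(3) by (simp add: homology_class_eq_iff)
      moreover have "(homology_class Y I k a, homology_class Z I k b) \<in> carrier (?MY \<times>\<times> ?MZ)"
        using ab by (simp add: carrier)
      ultimately show "v \<in> ?g ` carrier (?MY \<times>\<times> ?MZ)" by (rule image_eqI)
    qed
  qed
  ultimately have epi: "?g \<in> epi (?MY \<times>\<times> ?MZ) ?MX" by (simp add: epi_def)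

  have "?f ` carrier ?MW = kernel (?MY \<times>\<times> ?MZ) ?MX ?g"
  proof (intro equalityI subsetI)
    fix p assume "p \<in> ?f ` carrier ?MW"
    then obtain c where c: "c \<in> MC_cycles W I k" "p = ?f (homology_class W I k c)" by (auto simp: carrier)
    have p: "p = (homology_class Y I k c, homology_class Z I k (- c))" using c f by simp
    have "?g p = \<one>\<^bsub>?MX\<^esub>" unfolding p g by (simp add: one_MH)
    moreover have "p \<in> carrier (?MY \<times>\<times> ?MZ)" unfolding p using cycles[OF c(1)] by (simp add: carrier)
    ultimately show "p \<in> kernel (?MY \<times>\<times> ?MZ) ?MX ?g" by (simp add: kernel_def)
  next
    fix p assume "p \<in> kernel (?MY \<times>\<times> ?MZ) ?MX ?g"
    then have "p \<in> carrier (?MY \<times>\<times> ?MZ)" and one_p: "?g p = \<one>\<^bsub>?MX\<^esub>" by (simp_all add: kernel_def)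
    then obtain a b where p: "a \<in> MC_cycles Y I k" "b \<in> MC_cycles Z I k"
        "p = (homology_class Y I k a, homology_class Z I k b)" by (auto simp: carrier)
    have "a + b \<in> MC_boundaries X I k"
      using one_p unfolding p(3) g by (simp add: one_MH homology_class_eq_iff)
    then obtain w where w: "w \<in> MC_cycles W I k" "a - w \<in> MC_boundaries Y I k" "b + w \<in> MC_boundaries Z I k"
      using exact_in_middle p by blast
    then have "p = ?f (homology_class W I k w)"
      unfolding f[OF w(1)] p(3) by (simp add: homology_class_eq_iff)
    moreover have "homology_class W I k w \<in> carrier ?MW" using w(1) by (simp add: carrier)
    ultimately show "p \<in> ?f ` carrier ?MW" by (rule image_eqI)
  qed
  then show ?thesis
    unfolding short_exact_def using mon epi cg comm_group_DirProd[OF cg(2,3)] by blast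
qed

end
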